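(* Let $G=(V_P\cup V_L,E)$ be a point-line graph with $|V_L|\ge2$ and let $x_i\in\mathbb{R}$ for each $i\in V_L$. Then $G$ can be realised as a minimally infinitesimally rigid bar-joint framework in $\mathbb{R}^2$ with $V_L$ as its set of horizontal slider joints, such that the position of each $i\in V_L$ is $(x_i,0)$, if and only if: $|E|=2|V_P|+|V_L|-1$; $x_i\ne x_j$ for each $ij\in E_{LL}$; and for all nonempty $F\subseteq E$, $$|F|\le2\nu_{V_P}(F)+\nu_{V_L}(F)-1-\sum_{H\in C((G[F])^P)}\max\bigl\{0,\ 2-|\{x_j: ij\in F\cap E_{PL},\ i\in V(H)\}|\bigr\}.$$
   Context: A point-line graph has vertex set partitioned into $V_P$ and $V_L$, edges split into $E_{PP},E_{PL},E_{LL}$ by endpoint types (for $ij\in E_{PL}$, $i\in V_P$, $j\in V_L$). $\nu_Y(F)$ is the number of vertices of $Y$ incident to edges of $F$; $G[F]$ is the subgraph formed by the edges $F$ and their endpoints; for a point-line graph $K$, $K^P$ is the graph (possibly with loops) on the $V_P$-vertices of $K$ obtained by deleting $V_L$-vertices and replacing each edge $ij\in E_{PL}$ by a loop at $i$; $C(H)$ is the set of connected components of $H$. A bar-joint framework with horizontal slider joints is a triple $(G,X,p)$ with $X\subseteq V(G)$ and $p:V(G)\to\mathbb{R}^2$; an infinitesimal motion is $\dot p:V\to\mathbb{R}^2$ with $\langle p_i-p_j,\dot p_i-\dot p_j\rangle=0$ for all edges $ij$ and with the second coordinate of $\dot p(v)$ equal to $0$ for all $v\in X$. It is infinitesimally rigid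 if horizontal translations are its only infinitesimal motions, and minimally infinitesimally rigid if moreover deleting any edge destroys this property. *)

theory Defs
  imports "HOL-Analysis.Analysis"
begin

section \<open>Graphs\<close>

text \<open>An edge is the set of its endpoints; a singleton edge is a loop.\<close>

record 'v graph =
  verts :: "'v set"
  edges :: "'v set set"

definition simple_graph :: "'v graph \<Rightarrow> bool" where
  "simple_graph G \<longleftrightarrow> finite (verts G) \<and> (\<forall>e\<in>edges G. e \<subseteq> verts G \<and> card e = 2)"

definition edge_subgraph :: "'v set set \<Rightarrow> 'v graph" where
  "edge_subgraph F = \<lparr>verts = \<Union>F, edges = F\<rparr>"

definition delete_edge :: "'v graph \<Rightarrow> 'v set \<Rightarrow> 'v graph" where
  "delete_edge G e = \<lparr>verts = verts G, edges = edges G - {e}\<rparr>"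

definition component_of :: "'v graph \<Rightarrow> 'v \<Rightarrow> 'v graph" where
  "component_of G u =
     (let W = {v \<in> verts G. (u, v) \<in> {(a, b). {a, b} \<in> edges G}\<^sup>*}
      in \<lparr>verts = W, edges = {e \<in> edges G. e \<subseteq> W}\<rparr>)"

definition graph_components :: "'v graph \<Rightarrow> 'v graph set" where
  "graph_components G = component_of G ` verts G"


section \<open>Point-line graphs\<close>

definition point_line_graph :: "'v set \<Rightarrow> 'v set \<Rightarrow> 'v graph \<Rightarrow> bool" where
  "point_line_graph VP VL G \<longleftrightarrow>
     simple_graph G \<and> verts G = VP \<union> VL \<and> VP \<inter> VL = {}"

definition edges_PP :: "'v set \<Rightarrow> 'v graph \<Rightarrow> 'v set set" where
  "edges_PP VP G = {e \<in> edges G. e \<subseteq> VP}"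

definition edges_PL :: "'v set \<Rightarrow> 'v set \<Rightarrow> 'v graph \<Rightarrow> 'v set set" where
  "edges_PL VP VL G = {e \<in> edges G. \<exists>i\<in>VP. \<exists>j\<in>VL. e = {i, j}}"

definition edges_LL :: "'v set \<Rightarrow> 'v graph \<Rightarrow> 'v set set" where
  "edges_LL VL G = {e \<in> edges G. e \<subseteq> VL}"

text \<open>The number of vertices of \<open>Y\<close> incident to edges of \<open>F\<close>.\<close>

definition nu :: "'v set \<Rightarrow> 'v set set \<Rightarrow> nat" where
  "nu Y F = card {v \<in> Y. \<exists>e\<in>F. v \<in> e}"

text \<open>
  The graph \<open>K\<^sup>P\<close>. Several point-line edges at the same point yield a single loop here;
  the multiplicity of loops does not affect the connected components.
\<close>

definition point_graph :: "'v set \<Rightarrow> 'v set \<Rightarrow> 'v graph \<Rightarrow> 'v graph" where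
  "point_graph VP VL K =
     \<lparr>verts = verts K \<inter> VP,
      edges = edges_PP VP K \<union> {{i} |i j. i \<in> VP \<and> j \<in> VL \<and> {i, j} \<in> edges_PL VP VL K}\<rparr>"


section \<open>Bar-joint frameworks with horizontal slider joints\<close>

text \<open>
  Only the values of the placement \<open>p\<close> and of the motion \<open>q\<close> on \<open>verts G\<close> matter;
  \<open>X \<subseteq> verts G\<close> is the set of slider joints.
\<close>

definition infinitesimal_motion ::
    "'v graph \<Rightarrow> 'v set \<Rightarrow> ('v \<Rightarrow> real^2) \<Rightarrow> ('v \<Rightarrow> real^2) \<Rightarrow> bool" where
  "infinitesimal_motion G X p q \<longleftrightarrow>
     (\<forall>i j. {i, j} \<in> edges G \<longrightarrow> (p i - p j) \<bullet> (q i - q j) = 0) \<and>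
     (\<forall>v\<in>X. q v $ 2 = 0)"

definition horizontal_translation :: "'v graph \<Rightarrow> ('v \<Rightarrow> real^2) \<Rightarrow> bool" where
  "horizontal_translation G q \<longleftrightarrow> (\<exists>c::real. \<forall>v\<in>verts G. q v = vector [c, 0])"

definition infinitesimally_rigid :: "'v graph \<Rightarrow> 'v set \<Rightarrow> ('v \<Rightarrow> real^2) \<Rightarrow> bool" where
  "infinitesimally_rigid G X p \<longleftrightarrow>
     (\<forall>q. infinitesimal_motion G X p q \<longrightarrow> horizontal_translation G q)"

definition minimally_infinitesimally_rigid ::
    "'v graph \<Rightarrow> 'v set \<Rightarrow> ('v \<Rightarrow> real^2) \<Rightarrow> bool" where
  "minimally_infinitesimally_rigid G X p \<longleftrightarrow>
     infinitesimally_rigid G X p \<and>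
     (\<forall>e\<in>edges G. \<not> infinitesimally_rigid (delete_edge G e) X p)"

end

theory Submission
  imports Defs "HOL-Analysis.Finite_Function_Topology"
begin

text \<open>
  Necessity: the rows of the rigidity matrix are independent, while for every \<open>F\<close> they are orthogonal
  to the horizontal translation and, for each component of the point graph, to the rotation about its
  only anchor or, if it has no anchor, to all rotations and vertical translations. These motions
  are independent.

  Sufficiency: after a projective change of coordinates the constraint of an edge \<open>e\<close> becomes a vector
  in the intersection of a fixed plane \<open>U e\<close>, which depends only on \<open>x\<close>, with the hyperplane normal to
  \<open>h\<close>, where the entries of \<open>h\<close> encode the placement of the points. The count says that
  the planes of \<open>F\<close> span at least \<open>card F + 1\<close> dimensions. Hence one can choose independent vectors
  \<open>y e \<in> U e\<close> generically, and a vector \<open>h\<close> normal to all of them yields the placement. This is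
  Lovasz's theorem on Dilworth truncations, specialised to planes.
\<close>

section \<open>Linear algebra\<close>

text \<open>The obstacle to sufficiency is that the rows of the rigidity matrix depend on the
  placement that is sought. The change of coordinates exchanges the x-axis with the line at
  infinity: the slider at (x, 0) becomes the point at infinity in direction (x, 1), and a point with
  new coordinates (A, B) is seen from it only through the linear form A - x B. This is why the
  planes are known before any placement.

  The unit horizontal translation is recorded by \<open>h\<close> itself, and \<open>h\<close> kills
  every chosen vector; this is the origin of the surplus 1 in the count. The argument can therefore
  run backwards: the vectors \<open>y e\<close> are chosen without a placement, and \<open>h\<close>
  is read off from them. Independence alone is not enough for that, because \<open>h\<close> must
  also be nonzero at finitely many prescribed vectors; the transversal has to keep these out of its
  span.\<close>

lemma independent_if_dual_functionals:
  fixes B :: "'a::real_vector set"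
  assumes "\<And>b. b \<in> B \<Longrightarrow> \<exists>\<phi> :: 'a \<Rightarrow> real. linear \<phi> \<and> \<phi> b \<noteq> 0 \<and> (\<forall>c\<in>B - {b}. \<phi> c = 0)"
  shows "independent B"
  unfolding dependent_def using assms linear_eq_0_on_span by (metis (no_types, lifting))

lemma notin_span_if_functional:
  fixes \<phi> :: "'a::real_vector \<Rightarrow> real"
  assumes "linear \<phi>" "\<And>y. y \<in> S \<Longrightarrow> \<phi> y = 0" "\<phi> v \<noteq> 0"
  shows "v \<notin> span S"
  using assms linear_eq_0_on_span by metis

lemma separating_functional:
  fixes S :: "'a::real_vector set"
  assumes "v \<notin> span S"
  obtains \<phi> :: "'a \<Rightarrow> real" where "linear \<phi>" "\<And>y. y \<in> S \<Longrightarrow> \<phi> y = 0" "\<phi> v = 1"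
proof -
  obtain B where B: "B \<subseteq> S" "independent B" "S \<subseteq> span B"
    using maximal_independent_subset by blast
  then have v: "v \<notin> span B"
    using assms span_mono by blast
  then have "independent (insert v B)"
    using B independent_insertI by blast
  from linear_independent_extend[OF this, of "\<lambda>b. if b = v then 1 else 0 :: real"]
  obtain \<phi> where \<phi>: "linear \<phi>" "\<forall>b\<in>insert v B. \<phi> b = (if b = v then 1 else 0 :: real)"
    by blast
  have "\<phi> y = 0" if "y \<in> span B" for y
  proof (rule linear_eq_0_on_span[OF \<phi>(1) _ that])
    show "\<phi> b = 0" if "b \<in> B" for b
      using that \<phi>(2) v span_base by force
  qed
  then show thesis
    using B(3) \<phi> by (intro that[of \<phi>]) auto
qed

text \<open>The ambient space may be infinite-dimensional, and \<open>dim\<close> is 0 on a set with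
  an infinite basis, so the finiteness of \<open>W\<close> carries the monotonicity.\<close>

lemma dim_mono_finite:
  fixes W :: "'a::real_vector set"
  assumes "finite W" "V \<subseteq> span W"
  shows "dim V \<le> dim W"
proof -
  obtain B where B: "B \<subseteq> W" "independent B" "W \<subseteq> span B" "card B = dim W"
    using basis_exists by blast
  then have "V \<subseteq> span B"
    using assms(2) by (meson span_minimal subset_trans subspace_span)
  then show ?thesis
    using dim_le_card[of V B] B finite_subset assms(1) by metis
qed

lemma dim_insert_finite:
  fixes W :: "'a::real_vector set"
  assumes "finite W" "v \<notin> span W"
  shows "dim (insert v W) = dim W + 1"
proof -
  obtain B where B: "B \<subseteq> W" "independent B" "W \<subseteq> span B" "card B = dim W"
    using basis_exists by blast
  have fin: "finite B"
    using B assms finite_subset by blast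
  have "v \<notin> span B"
    using B(1) assms(2) span_mono by blast
  then have "independent (insert v B)" "v \<notin> B"
    using B(2) independent_insertI span_base by blast+
  then have "independent (insert v B)" "card (insert v B) = dim W + 1"
    using B(4) fin by simp_all
  moreover have "insert v W \<subseteq> span (insert v B)"
    using B(3) span_mono[of B "insert v B"] by (auto simp: span_base)
  ultimately show ?thesis
    using B(1) by (metis basis_card_eq_dim insert_mono)
qed

lemma dim_Un_finite_le:
  fixes V W :: "'a::real_vector set"
  assumes "finite V" "finite W"
  shows "dim (V \<union> W) \<le> dim V + card W"
  using assms(2)
proof (induction W)
  case (insert w W)
  have "dim (insert w (V \<union> W)) \<le> dim (V \<union> W) + 1"
  proof (cases "w \<in> span (V \<union> W)")
    case True
    then have "insert w (V \<union> W) \<subseteq> span (V \<union> W)"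
      by (auto simp: span_base)
    then have "dim (insert w (V \<union> W)) \<le> dim (V \<union> W)"
      using assms(1) insert.hyps by (intro dim_mono_finite) auto
    then show ?thesis by simp
  next
    case False
    then show ?thesis
      using dim_insert_finite[of "V \<union> W" w] assms(1) insert.hyps by auto
  qed
  then show ?case
    using insert by auto
qed auto

text \<open>By Steinitz, a vector of \<open>T\<close> outside \<open>span B\<close> would extend
  \<open>B\<close> to an independent set larger than \<open>T\<close>. With \<open>T\<close> the
  unit vectors, this turns the edge count into a spanning statement.\<close>

lemma spanning_if_independent_card:
  fixes B T :: "'a::real_vector set"
  assumes "finite T" "independent B" "B \<subseteq> span T" "card T \<le> card B"
  shows "T \<subseteq> span B"
proof (rule ccontr)
  assume "\<not> T \<subseteq> span B"
  then obtain v where v: "v \<in> T" "v \<notin> span B" by blast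
  then have "independent (insert v B)" "insert v B \<subseteq> span T"
    using assms independent_insertI by (auto simp: span_base)
  then have "card (insert v B) \<le> card T"
    using independent_span_bound[OF assms(1)] by blast
  moreover have "finite B" "v \<notin> B"
    using independent_span_bound[OF assms(1-3)] v span_base by blast+
  ultimately show False
    using assms(4) by simp
qed

section \<open>Generic transversals of planes\<close>

text \<open>Two parameters with values in the same subspace would put \<open>v\<close>, and then
  \<open>u\<close>, into it. So each subspace forbids at most one parameter, and infinitely many
  remain.\<close>

lemma line_avoids_subspaces:
  fixes u v :: "'a::real_vector"
  assumes "finite \<W>" "\<And>W. W \<in> \<W> \<Longrightarrow> subspace W" "\<And>W. W \<in> \<W> \<Longrightarrow> u \<notin> W \<or> v \<notin> W"
  obtains \<tau> :: real where "\<And>W. W \<in> \<W> \<Longrightarrow> u + \<tau> *\<^sub>R v \<notin> W"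
proof -
  have "finite {\<tau>. u + \<tau> *\<^sub>R v \<in> W}" if W: "W \<in> \<W>" for W
  proof (cases "{\<tau>. u + \<tau> *\<^sub>R v \<in> W} = {}")
    case False
    then obtain \<sigma> where \<sigma>: "u + \<sigma> *\<^sub>R v \<in> W" by blast
    have "\<tau> = \<sigma>" if \<tau>: "u + \<tau> *\<^sub>R v \<in> W" for \<tau>
    proof (rule ccontr)
      assume "\<tau> \<noteq> \<sigma>"
      have "(u + \<tau> *\<^sub>R v) - (u + \<sigma> *\<^sub>R v) \<in> W"
        using W assms(2) \<sigma> \<tau> subspace_diff by blast
      then have "(1 / (\<tau> - \<sigma>)) *\<^sub>R ((\<tau> - \<sigma>) *\<^sub>R v) \<in> W"
        using W assms(2) subspace_scale by (metis add_diff_cancel_left scaleR_left_diff_distrib)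
      then have v: "v \<in> W"
        using \<open>\<tau> \<noteq> \<sigma>\<close> by simp
      then have "(u + \<sigma> *\<^sub>R v) - \<sigma> *\<^sub>R v \<in> W"
        using W assms(2) \<sigma> subspace_diff subspace_scale by blast
      then show False
        using v W assms(3) by auto
    qed
    then have "{\<tau>. u + \<tau> *\<^sub>R v \<in> W} \<subseteq> {\<sigma>}" by blast
    then show ?thesis
      using finite_subset by blast
  qed auto
  then have "finite (\<Union>W\<in>\<W>. {\<tau>. u + \<tau> *\<^sub>R v \<in> W})"
    using assms(1) by blast
  then obtain \<tau> where "\<tau> \<notin> (\<Union>W\<in>\<W>. {\<tau>. u + \<tau> *\<^sub>R v \<in> W})"
    using ex_new_if_finite infinite_UNIV_char_0 by blast
  then show thesis
    by (intro that[of \<tau>]) auto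
qed

text \<open>
  A Rado-type transversal for planes. The vectors are chosen one after the other, each outside the
  spans of the families for which the hypothesis is tight, so that the hypothesis survives modulo
  the chosen vector.
\<close>

lemma independent_transversal:
  fixes p q :: "'e \<Rightarrow> 'a::real_vector"
  assumes "finite E" "finite Y" "finite S" "\<And>s. s \<in> S \<Longrightarrow> s \<notin> span Y"
    and "\<And>F. F \<subseteq> E \<Longrightarrow> F \<noteq> {} \<Longrightarrow> dim Y + card F + 1 \<le> dim (Y \<union> p ` F \<union> q ` F)"
  shows "\<exists>t. (\<forall>s\<in>S. s \<notin> span (Y \<union> (\<lambda>e. p e + t e *\<^sub>R q e) ` E)) \<and>
             dim (Y \<union> (\<lambda>e. p e + t e *\<^sub>R q e) ` E) = dim Y + card E"
  using assms(1,2,4,5)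
proof (induction E arbitrary: Y)
  case empty
  then show ?case by simp
next
  case (insert a E)
  have fin: "finite (Y \<union> p ` F \<union> q ` F)" if "F \<subseteq> insert a E" for F
    using insert.hyps insert.prems(1) that finite_subset by blast
  define tight where "tight = {F. F \<subseteq> E \<and> F \<noteq> {} \<and> dim (Y \<union> p ` F \<union> q ` F) = dim Y + card F + 1}"
  \<comment> \<open>Besides the spans of tight families, \<open>y\<close> has to avoid
    \<open>span Y\<close>, so that the dimension grows, and the span of \<open>Y\<close> with each
    \<open>s\<close>, so that \<open>s\<close> stays outside by the exchange property.\<close>
  define \<W> where "\<W> = insert (span Y)
    ((\<lambda>F. span (Y \<union> p ` F \<union> q ` F)) ` tight \<union> (\<lambda>s. span (insert s Y)) ` S)"
  \<comment> \<open>The hypothesis for the single edge \<open>a\<close> makes its plane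
    two-dimensional modulo \<open>Y\<close>, so one further vector cannot absorb it.\<close>
  have "dim (Y \<union> {p a, q a}) \<ge> dim Y + 2"
    using insert.prems(3)[of "{a}"] by (simp add: insert_commute)
  moreover have "dim (Y \<union> {p a, q a}) \<le> dim Y + 1" if "p a \<in> span (insert s Y)" "q a \<in> span (insert s Y)" for s
  proof -
    have "dim (Y \<union> {p a, q a}) \<le> dim (insert s Y)"
      using that insert.prems(1) by (intro dim_mono_finite) (auto simp: span_base)
    then show ?thesis
      using dim_Un_finite_le[of Y "{s}"] insert.prems(1) by simp
  qed
  ultimately have S: "p a \<notin> span (insert s Y) \<or> q a \<notin> span (insert s Y)" for s
    by fastforce
  \<comment> \<open>If a tight family absorbed the plane of \<open>a\<close>, adding
    \<open>a\<close> to it would raise the required dimension by one and the actual dimension not at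
    all.\<close>
  have T: "p a \<notin> span (Y \<union> p ` F \<union> q ` F) \<or> q a \<notin> span (Y \<union> p ` F \<union> q ` F)" if "F \<in> tight" for F
  proof (rule ccontr)
    assume *: "\<not> ?thesis"
    have F: "F \<subseteq> E" "dim (Y \<union> p ` F \<union> q ` F) = dim Y + card F + 1"
      using that by (auto simp: tight_def)
    then have "a \<notin> F" "finite F"
      using insert.hyps finite_subset by blast+
    have "dim Y + card (insert a F) + 1 \<le> dim (Y \<union> p ` insert a F \<union> q ` insert a F)"
      using insert.prems(3)[of "insert a F"] F by blast
    also have "\<dots> \<le> dim (Y \<union> p ` F \<union> q ` F)"
      using * F fin by (intro dim_mono_finite) (auto intro: span_base)
    finally show False
      using F \<open>a \<notin> F\<close> \<open>finite F\<close> by simp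
  qed
  have "finite tight"
    unfolding tight_def using insert.hyps(1) by (intro finite_subset[OF _ finite_Pow_iff[THEN iffD2]]) blast+
  then have "finite \<W>"
    using assms(3) unfolding \<W>_def by blast
  moreover have "subspace W" if "W \<in> \<W>" for W
    using that unfolding \<W>_def by blast
  \<comment> \<open>Taking 0 for \<open>s\<close> covers the subspace \<open>span Y\<close>.\<close>
  moreover have "p a \<notin> W \<or> q a \<notin> W" if "W \<in> \<W>" for W
    using that S T S[of 0] unfolding \<W>_def span_insert_0 by blast
  ultimately obtain \<tau> where \<tau>: "\<And>W. W \<in> \<W> \<Longrightarrow> p a + \<tau> *\<^sub>R q a \<notin> W"
    using line_avoids_subspaces by metis
  define y where "y = p a + \<tau> *\<^sub>R q a"
  have y: "y \<notin> span Y"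
    using \<tau> by (auto simp: \<W>_def y_def)
  have dimY: "dim (insert y Y) = dim Y + 1"
    using dim_insert_finite y insert.prems(1) by blast
  have "\<exists>t. (\<forall>s\<in>S. s \<notin> span (insert y Y \<union> (\<lambda>e. p e + t e *\<^sub>R q e) ` E)) \<and>
            dim (insert y Y \<union> (\<lambda>e. p e + t e *\<^sub>R q e) ` E) = dim (insert y Y) + card E"
  proof (rule insert.IH)
    show "finite (insert y Y)"
      using insert.prems by simp
    show "s \<notin> span (insert y Y)" if "s \<in> S" for s
    proof
      assume "s \<in> span (insert y Y)"
      then have "y \<in> span (insert s Y)"
        using in_span_insert insert.prems(2) that by blast
      then show False
        using \<tau> that by (auto simp: \<W>_def y_def)
    qed
    show "dim (insert y Y) + card F + 1 \<le> dim (insert y Y \<union> p ` F \<union> q ` F)"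
      if F: "F \<subseteq> E" "F \<noteq> {}" for F
    \<comment> \<open>For a tight family the right side grows by one, since \<open>y\<close> lies
      outside its span; for any other family the slack of one pays for the growth of
      \<open>dim Y\<close>.\<close>
    proof (cases "F \<in> tight")
      case True
      then have "y \<notin> span (Y \<union> p ` F \<union> q ` F)"
        using \<tau> by (auto simp: \<W>_def y_def)
      then show ?thesis
        using dim_insert_finite[OF fin[of F], of y] F(1) True dimY subset_insertI2[OF F(1)]
        by (simp add: tight_def)
    next
      case False
      then have "dim Y + card F + 1 < dim (Y \<union> p ` F \<union> q ` F)"
        using insert.prems(3)[of F] F by (auto simp: tight_def less_le)
      also have "\<dots> \<le> dim (insert y Y \<union> p ` F \<union> q ` F)"
        using fin[of F] F by (intro dim_mono_finite) (auto intro: span_base)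
      finally show ?thesis
        using dimY by simp
    qed
  qed
  then obtain t where t: "\<forall>s\<in>S. s \<notin> span (insert y Y \<union> (\<lambda>e. p e + t e *\<^sub>R q e) ` E)"
      "dim (insert y Y \<union> (\<lambda>e. p e + t e *\<^sub>R q e) ` E) = dim (insert y Y) + card E"
    by blast
  have "Y \<union> (\<lambda>e. p e + (t(a := \<tau>)) e *\<^sub>R q e) ` insert a E = insert y Y \<union> (\<lambda>e. p e + t e *\<^sub>R q e) ` E"
  proof -
    have "(\<lambda>e. p e + (t(a := \<tau>)) e *\<^sub>R q e) ` E = (\<lambda>e. p e + t e *\<^sub>R q e) ` E"
      using insert.hyps(2) by (intro image_cong) auto
    then show ?thesis
      by (simp add: y_def)
  qed
  then show ?case
    using t dimY insert.hyps by (intro exI[of _ "t(a := \<tau>)"]) simp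
qed

lemma independent_image_if_dim_eq_card:
  fixes f :: "'e \<Rightarrow> 'a::real_vector"
  assumes "finite E" "dim (f ` E) = card E"
  shows "independent (f ` E)" "inj_on f E"
proof -
  obtain B where B: "B \<subseteq> f ` E" "independent B" "card B = card E"
    using basis_exists[of "f ` E"] assms(2) by metis
  then have "B = f ` E"
    using assms(1) card_image_le[of E f] by (intro card_subset_eq card_seteq) auto
  then show "independent (f ` E)" "inj_on f E"
    using B eq_card_imp_inj_on[OF assms(1), of f] by auto
qed

section \<open>Finitely supported vectors and their functionals\<close>

text \<open>The index type need not be finite, so vectors are finitely supported functions, while an
  arbitrary function on the indices acts on them through \<open>pairing\<close>.\<close>

abbreviation unit_vec :: "'c \<Rightarrow> 'c \<Rightarrow>\<^sub>0 real" where
  "unit_vec c \<equiv> Poly_Mapping.single c 1"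

definition pairing :: "('c \<Rightarrow> real) \<Rightarrow> ('c \<Rightarrow>\<^sub>0 real) \<Rightarrow> real" where
  "pairing m f = (\<Sum>c\<in>Poly_Mapping.keys f. Poly_Mapping.lookup f c * m c)"

lemma pairing_superset:
  assumes "finite A" "Poly_Mapping.keys f \<subseteq> A"
  shows "pairing m f = (\<Sum>c\<in>A. Poly_Mapping.lookup f c * m c)"
  unfolding pairing_def using assms by (intro sum.mono_neutral_left) (auto simp: in_keys_iff)

lemma pairing_unit_vec [simp]: "pairing m (unit_vec c) = m c"
  by (simp add: pairing_def)

lemma lookup_scaleR: "Poly_Mapping.lookup (r *\<^sub>R f) c = r *\<^sub>R Poly_Mapping.lookup f c"
proof -
  have "finite {c. r *\<^sub>R Poly_Mapping.lookup f c \<noteq> 0}"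
    by (rule finite_subset[OF _ finite_keys[of f]]) (auto simp: in_keys_iff)
  then show ?thesis
    by (simp add: scaleR_poly_mapping_def)
qed

lemma linear_pairing: "linear (pairing m)"
proof
  fix f g :: "'a \<Rightarrow>\<^sub>0 real" and r :: real
  have *: "pairing m k = (\<Sum>c\<in>Poly_Mapping.keys f \<union> Poly_Mapping.keys g. Poly_Mapping.lookup k c * m c)"
    if "Poly_Mapping.keys k \<subseteq> Poly_Mapping.keys f \<union> Poly_Mapping.keys g" for k
    using that by (intro pairing_superset) auto
  show "pairing m (f + g) = pairing m f + pairing m g"
    using Poly_Mapping.keys_add[of f g]
    by (simp add: * lookup_add distrib_right sum.distrib)
  have "Poly_Mapping.keys (r *\<^sub>R f) \<subseteq> Poly_Mapping.keys f"
    by (auto simp: in_keys_iff lookup_scaleR)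
  then show "pairing m (r *\<^sub>R f) = r *\<^sub>R pairing m f"
    using pairing_superset[of "Poly_Mapping.keys f" "r *\<^sub>R f" m]
    by (simp add: pairing_def lookup_scaleR sum_distrib_left mult.assoc)
qed

lemma inj_unit_vec: "inj unit_vec"
proof
  fix c d :: 'a
  assume "unit_vec c = unit_vec d"
  then have "Poly_Mapping.keys (unit_vec c) = Poly_Mapping.keys (unit_vec d)"
    by (rule arg_cong)
  then show "c = d"
    by simp
qed

lemma independent_unit_vec: "independent (unit_vec ` C)"
proof (rule independent_if_dual_functionals)
  fix b :: "'a \<Rightarrow>\<^sub>0 real"
  assume "b \<in> unit_vec ` C"
  then obtain c where "b = unit_vec c" by blast
  then show "\<exists>\<phi> :: ('a \<Rightarrow>\<^sub>0 real) \<Rightarrow> real. linear \<phi> \<and> \<phi> b \<noteq> 0 \<and> (\<forall>c\<in>unit_vec ` C - {b}. \<phi> c = 0)"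
    by (intro exI[of _ "pairing (\<lambda>d. if d = c then 1 else 0)"]) (auto simp: linear_pairing split: if_splits)
qed

lemma unit_vec_nonzero: "unit_vec c \<noteq> 0"
  using pairing_unit_vec[of "\<lambda>_. 1" c] linear_0[OF linear_pairing, of "\<lambda>_. 1"] by (metis zero_neq_one)

lemma card_unit_vec_image: "card (unit_vec ` C) = card C"
  by (intro card_image inj_on_subset[OF inj_unit_vec]) simp

section \<open>Components\<close>

lemma verts_component_of:
  "verts (component_of G u) = {v \<in> verts G. (u, v) \<in> {(a, b). {a, b} \<in> edges G}\<^sup>*}"
  by (simp add: component_of_def Let_def)

lemma component_of_eq:
  assumes "(u, v) \<in> {(a, b). {a, b} \<in> edges G}\<^sup>*"
  shows "component_of G u = component_of G v"
proof -
  have "sym ({(a, b). {a, b} \<in> edges G}\<^sup>*)"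
    by (intro sym_rtrancl) (auto simp: sym_def insert_commute)
  then have "(v, u) \<in> {(a, b). {a, b} \<in> edges G}\<^sup>*"
    using assms by (meson symD)
  then have "(u, w) \<in> {(a, b). {a, b} \<in> edges G}\<^sup>* \<longleftrightarrow> (v, w) \<in> {(a, b). {a, b} \<in> edges G}\<^sup>*" for w
    using assms by (meson rtrancl_trans)
  then show ?thesis
    by (simp add: component_of_def)
qed

lemma component_eq_component_of:
  assumes "H \<in> graph_components G" "v \<in> verts H"
  shows "H = component_of G v"
  using assms component_of_eq unfolding graph_components_def by (auto simp: verts_component_of)

lemma component_unique:
  assumes "H \<in> graph_components G" "H' \<in> graph_components G" "v \<in> verts H" "v \<in> verts H'"
  shows "H = H'"
  using assms component_eq_component_of by metis

lemma component_subset: "H \<in> graph_components G \<Longrightarrow> verts H \<subseteq> verts G"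
  by (auto simp: graph_components_def verts_component_of)

lemma component_nonempty:
  assumes "H \<in> graph_components G"
  obtains v where "v \<in> verts H"
proof -
  obtain u where "u \<in> verts G" "H = component_of G u"
    using assms by (auto simp: graph_components_def)
  then show thesis
    by (intro that[of u]) (simp add: verts_component_of)
qed

lemma ex_component:
  assumes "v \<in> verts G"
  obtains H where "H \<in> graph_components G" "v \<in> verts H"
  using assms that[of "component_of G v"] by (auto simp: graph_components_def verts_component_of)

lemma component_closed:
  assumes "H \<in> graph_components G" "v \<in> verts H" "{v, w} \<in> edges G" "w \<in> verts G"
  shows "w \<in> verts H"
  using assms component_eq_component_of[OF assms(1,2)] by (auto simp: verts_component_of)

lemma component_induct:
  assumes "H \<in> graph_components G" "u \<in> verts H" "v \<in> verts H" "P u"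
    and "\<And>a b. P a \<Longrightarrow> {a, b} \<in> edges G \<Longrightarrow> P b"
  shows "P v"
proof -
  have "(u, v) \<in> {(a, b). {a, b} \<in> edges G}\<^sup>*"
    using assms(3) component_eq_component_of[OF assms(1,2)] by (auto simp: verts_component_of)
  then show ?thesis
    by (induction rule: rtrancl_induct) (use assms(4,5) in auto)
qed


section \<open>Point-line graphs with oriented edges\<close>

text \<open>Edges are sets, but rows need ordered ends. The orientation is arbitrary except that a
  mixed edge runs from its point to its line; thus \<open>t e \<in> VP\<close> singles out the edges
  between points.\<close>

locale oriented_point_line_graph =
  fixes VP VL :: "'v set" and G :: "'v graph" and x :: "'v \<Rightarrow> real" and s t :: "'v set \<Rightarrow> 'v"
  assumes point_line: "point_line_graph VP VL G"
    and ends: "e \<in> edges G \<Longrightarrow> e = {s e, t e}"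
    and orient: "e \<in> edges G \<Longrightarrow> t e \<in> VP \<Longrightarrow> s e \<in> VP"
begin

lemma finite_VP: "finite VP" and finite_VL: "finite VL" and disjoint: "VP \<inter> VL = {}"
  and verts_G: "verts G = VP \<union> VL"
  using point_line by (auto simp: point_line_graph_def simple_graph_def dest: sym)

lemma finite_edges: "finite (edges G)"
proof (rule finite_subset)
  show "edges G \<subseteq> Pow (VP \<union> VL)"
    using point_line by (auto simp: point_line_graph_def simple_graph_def)
  show "finite (Pow (VP \<union> VL))"
    using finite_VP finite_VL by simp
qed

lemma s_neq_t: "e \<in> edges G \<Longrightarrow> s e \<noteq> t e"
proof
  assume e: "e \<in> edges G" "s e = t e"
  then have "card e = 2"
    using point_line by (auto simp: point_line_graph_def simple_graph_def)
  then show False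
    using ends[OF e(1)] e(2) by (metis card_2_iff' insertCI insert_absorb2 singletonD)
qed

lemma edge_cases:
  assumes "e \<in> edges G"
  obtains (PP) "s e \<in> VP" "t e \<in> VP" "s e \<notin> VL" "t e \<notin> VL"
    | (PL) "s e \<in> VP" "t e \<in> VL" "s e \<notin> VL" "t e \<notin> VP"
    | (LL) "s e \<in> VL" "t e \<in> VL" "s e \<notin> VP" "t e \<notin> VP"
proof -
  have "e \<subseteq> VP \<union> VL"
    using assms point_line by (auto simp: point_line_graph_def simple_graph_def)
  then have "s e \<in> VP \<union> VL" "t e \<in> VP \<union> VL"
    using ends[OF assms] by blast+
  then show thesis
    using that orient[OF assms] disjoint by blast
qed

section \<open>Components of the point graph and their anchors\<close>

definition comps :: "'v set set \<Rightarrow> 'v graph set" where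
  "comps F = graph_components (point_graph VP VL (edge_subgraph F))"

text \<open>Positions are collected, not joints: sliders at the same place leave a component the
  same rotation.\<close>

definition anchors :: "'v set set \<Rightarrow> 'v graph \<Rightarrow> real set" where
  "anchors F H = {x j |i j. {i, j} \<in> F \<inter> edges_PL VP VL G \<and> i \<in> verts H \<and> j \<in> VL}"

definition deficit :: "'v set set \<Rightarrow> int" where
  "deficit F = (\<Sum>H\<in>comps F. max 0 (2 - int (card (anchors F H))))"

text \<open>
  The coordinate \<open>(v, False)\<close> is horizontal, \<open>(v, True)\<close> is vertical; slider joints have no
  vertical coordinate.
\<close>

definition coords :: "'v set \<Rightarrow> ('v \<times> bool) set" where
  "coords W = (W \<inter> VP) \<times> UNIV \<union> (W \<inter> VL) \<times> {False}"

lemma coords_iff: "(v, b) \<in> coords W \<longleftrightarrow> v \<in> W \<and> (v \<in> VP \<or> v \<in> VL \<and> \<not> b)"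
  by (auto simp: coords_def)

lemma finite_coords: "finite (coords W)"
  using finite_VP finite_VL by (simp add: coords_def)

lemma card_coords: "card (coords W) = 2 * card (W \<inter> VP) + card (W \<inter> VL)"
proof -
  have "card (coords W) = card ((W \<inter> VP) \<times> (UNIV :: bool set)) + card ((W \<inter> VL) \<times> {False})"
    unfolding coords_def using finite_VP finite_VL disjoint by (intro card_Un_disjoint) auto
  then show ?thesis
    by (simp add: card_cartesian_product)
qed

lemma card_coords_Union: "card (coords (\<Union>F)) = 2 * nu VP F + nu VL F"
proof -
  have "{v \<in> Y. \<exists>e\<in>F. v \<in> e} = \<Union>F \<inter> Y" for Y
    by blast
  then show ?thesis
    by (simp add: card_coords nu_def)
qed

lemma card_coords_UNIV: "card (coords UNIV) = 2 * card VP + card VL"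
  by (simp add: card_coords)

lemma in_comps_subset:
  assumes "H \<in> comps F"
  shows "verts H \<subseteq> \<Union>F \<inter> VP"
  using component_subset[OF assms[unfolded comps_def]]
  by (simp add: point_graph_def edge_subgraph_def)

lemma finite_comps: "finite (comps F)"
  using finite_VP by (simp add: comps_def graph_components_def point_graph_def)

lemma comps_unique:
  "H \<in> comps F \<Longrightarrow> H' \<in> comps F \<Longrightarrow> v \<in> verts H \<Longrightarrow> v \<in> verts H' \<Longrightarrow> H = H'"
  unfolding comps_def by (rule component_unique)

lemma ex_comps:
  assumes "v \<in> \<Union>F" "v \<in> VP"
  obtains H where "H \<in> comps F" "v \<in> verts H"
  using assms ex_component[of v "point_graph VP VL (edge_subgraph F)"]
  unfolding comps_def by (auto simp: point_graph_def edge_subgraph_def)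

lemma point_edge_in_comps:
  assumes "H \<in> comps F" "F \<subseteq> edges G" "e \<in> F" "t e \<in> VP"
  shows "s e \<in> verts H \<longleftrightarrow> t e \<in> verts H"
proof -
  have e: "e = {s e, t e}" "s e \<in> VP"
    using assms ends orient by blast+
  have "{s e, t e} \<in> F"
    using e(1) assms(3) by metis
  moreover have "{s e, t e} \<subseteq> VP"
    using e(2) assms(4) by simp
  ultimately have "{s e, t e} \<in> edges (point_graph VP VL (edge_subgraph F))"
    by (simp add: point_graph_def edges_PP_def edge_subgraph_def)
  moreover have "s e \<in> \<Union>F" "t e \<in> \<Union>F"
    using e assms(3) by blast+
  then have "s e \<in> verts (point_graph VP VL (edge_subgraph F))"
      "t e \<in> verts (point_graph VP VL (edge_subgraph F))"
    using e(2) assms(4) by (simp_all add: point_graph_def edge_subgraph_def)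
  ultimately show ?thesis
    using component_closed[OF assms(1)[unfolded comps_def], of "s e" "t e"]
      component_closed[OF assms(1)[unfolded comps_def], of "t e" "s e"]
    by (auto simp: insert_commute)
qed

lemma comps_induct:
  assumes "H \<in> comps F" "F \<subseteq> edges G" "u \<in> verts H" "v \<in> verts H" "P u"
    and step: "\<And>e. e \<in> F \<Longrightarrow> t e \<in> VP \<Longrightarrow> P (s e) \<longleftrightarrow> P (t e)"
  shows "P v"
  using assms(1)[unfolded comps_def] assms(3-5)
proof (rule component_induct)
  fix a b
  assume P: "P a" and "{a, b} \<in> edges (point_graph VP VL (edge_subgraph F))"
  then consider "{a, b} \<in> F" "a \<in> VP" "b \<in> VP" | "a = b"
    by (auto simp: point_graph_def edges_PP_def edge_subgraph_def)
  then show "P b"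
  proof cases
    case 1
    have "{a, b} = {s {a, b}, t {a, b}}"
      using 1 assms(2) ends by blast
    then have "a = s {a, b} \<and> b = t {a, b} \<or> a = t {a, b} \<and> b = s {a, b}"
      by (metis doubleton_eq_iff)
    then show ?thesis
      using P step[OF 1(1)] 1(2,3) by metis
  qed (use P in simp)
qed

lemma anchors_iff:
  assumes "F \<subseteq> edges G" "H \<in> comps F"
  shows "\<xi> \<in> anchors F H \<longleftrightarrow> (\<exists>e\<in>F. s e \<in> verts H \<and> t e \<in> VL \<and> \<xi> = x (t e))"
proof
  assume "\<xi> \<in> anchors F H"
  then obtain i j where ij: "{i, j} \<in> F" "i \<in> verts H" "j \<in> VL" "\<xi> = x j"
    by (auto simp: anchors_def)
  then have "i \<in> VP" "{i, j} \<in> edges G"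
    using assms in_comps_subset by blast+
  then have "{i, j} = {s {i, j}, t {i, j}}" "t {i, j} \<in> VP \<longrightarrow> s {i, j} \<in> VP"
    using ends orient by blast+
  then have "s {i, j} = i \<and> t {i, j} = j"
    using \<open>i \<in> VP\<close> ij(3) disjoint by (metis disjoint_iff doubleton_eq_iff)
  then show "\<exists>e\<in>F. s e \<in> verts H \<and> t e \<in> VL \<and> \<xi> = x (t e)"
    using ij by (intro bexI[of _ "{i, j}"]) auto
next
  assume "\<exists>e\<in>F. s e \<in> verts H \<and> t e \<in> VL \<and> \<xi> = x (t e)"
  then obtain e where e: "e \<in> F" "s e \<in> verts H" "t e \<in> VL" "\<xi> = x (t e)" by blast
  then have "e = {s e, t e}" "s e \<in> VP" "e \<in> edges G"
    using assms ends in_comps_subset by blast+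
  then have "{s e, t e} \<in> F \<inter> edges_PL VP VL G"
    unfolding edges_PL_def using e by auto
  then show "\<xi> \<in> anchors F H"
    unfolding anchors_def using e by blast
qed

lemma finite_anchors:
  assumes "F \<subseteq> edges G" "H \<in> comps F"
  shows "finite (anchors F H)"
proof (rule finite_subset)
  show "anchors F H \<subseteq> (\<lambda>e. x (t e)) ` F"
    using anchors_iff[OF assms] by blast
  show "finite ((\<lambda>e. x (t e)) ` F)"
    using assms finite_edges finite_subset by blast
qed

lemma infinitesimal_motion_iff:
  "infinitesimal_motion G X p q \<longleftrightarrow>
     (\<forall>e\<in>edges G. (p (s e) - p (t e)) \<bullet> (q (s e) - q (t e)) = 0) \<and> (\<forall>v\<in>X. q v $ 2 = 0)"
  (is "_ \<longleftrightarrow> ?R \<and> _")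
proof -
  have "(\<forall>i j. {i, j} \<in> edges G \<longrightarrow> (p i - p j) \<bullet> (q i - q j) = 0) \<longleftrightarrow> ?R"
  proof safe
    fix e assume "\<forall>i j. {i, j} \<in> edges G \<longrightarrow> (p i - p j) \<bullet> (q i - q j) = 0" "e \<in> edges G"
    then show "(p (s e) - p (t e)) \<bullet> (q (s e) - q (t e)) = 0"
      using ends[of e] by metis
  next
    fix i j assume R: ?R and e: "{i, j} \<in> edges G"
    let ?e = "{i, j}"
    have "{i, j} = {s ?e, t ?e}"
      using ends e by blast
    then consider "i = s ?e" "j = t ?e" | "i = t ?e" "j = s ?e"
      by (metis doubleton_eq_iff)
    then show "(p i - p j) \<bullet> (q i - q j) = 0"
    proof cases
      case 1
      then show ?thesis using R e by metis
    next
      case 2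
      have "(p (s ?e) - p (t ?e)) \<bullet> (q (s ?e) - q (t ?e)) = 0"
        using R e by blast
      then have "(p j - p i) \<bullet> (q j - q i) = 0"
        using 2 by metis
      then show ?thesis
        by (metis inner_minus_left inner_minus_right minus_diff_eq neg_equal_0_iff_equal)
    qed
  qed
  then show ?thesis
    by (simp add: infinitesimal_motion_def)
qed

lemma delete_edge_point_line:
  "oriented_point_line_graph VP VL (delete_edge G e) s t"
proof
  show "point_line_graph VP VL (delete_edge G e)"
    using point_line by (auto simp: point_line_graph_def simple_graph_def delete_edge_def)
qed (auto simp: delete_edge_def dest: ends orient)

lemma infinitesimal_motion_delete_edge_iff:
  "infinitesimal_motion (delete_edge G e) X p q \<longleftrightarrow>
     (\<forall>f\<in>edges G - {e}. (p (s f) - p (t f)) \<bullet> (q (s f) - q (t f)) = 0) \<and> (\<forall>v\<in>X. q v $ 2 = 0)"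
proof -
  have "edges (delete_edge G e) = edges G - {e}"
    by (simp add: delete_edge_def)
  then show ?thesis
    using oriented_point_line_graph.infinitesimal_motion_iff[OF delete_edge_point_line] by metis
qed

section \<open>Sufficiency\<close>

text \<open>With A and B the values of \<open>h\<close> at the vertical and horizontal coordinate of
  a point, an edge between points yields the differences of A and of B, and a mixed edge yields A -
  x B in \<open>pvec\<close>. A bar between sliders lies on the axis and can only equate two
  horizontal velocities, so its plane does not involve \<open>x\<close>.\<close>

definition pvec :: "'v set \<Rightarrow> ('v \<times> bool) \<Rightarrow>\<^sub>0 real" where
  "pvec e = (if t e \<in> VP then unit_vec (s e, True) - unit_vec (t e, True)
     else if s e \<in> VP then unit_vec (s e, True) - x (t e) *\<^sub>R unit_vec (s e, False)
     else unit_vec (s e, False))"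

definition qvec :: "'v set \<Rightarrow> ('v \<times> bool) \<Rightarrow>\<^sub>0 real" where
  "qvec e = (if t e \<in> VP then unit_vec (s e, False) - unit_vec (t e, False)
     else unit_vec (t e, False))"

lemma pvec_qvec_in_span:
  assumes "e \<in> edges G"
  shows "pvec e \<in> span (unit_vec ` coords UNIV)" "qvec e \<in> span (unit_vec ` coords UNIV)"
proof -
  let ?U = "span (unit_vec ` coords UNIV) :: ('v \<times> bool \<Rightarrow>\<^sub>0 real) set"
  have u: "unit_vec c \<in> ?U" if "c \<in> coords UNIV" for c
    using that by (intro span_base imageI)
  have "s e \<in> VP \<union> VL" "t e \<in> VP \<union> VL"
    using assms by (cases rule: edge_cases; blast)+
  then have "unit_vec (s e, False) \<in> ?U" "unit_vec (t e, False) \<in> ?U"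
    by (auto intro: u simp: coords_iff)
  moreover have "unit_vec (v, True) \<in> ?U" if "v \<in> VP" for v
    using that by (intro u) (simp add: coords_iff)
  ultimately show "pvec e \<in> ?U" "qvec e \<in> ?U"
    using orient[OF assms] unfolding pvec_def qvec_def by (simp_all add: span_diff span_scale)
qed

lemma qvec_nonzero:
  assumes "e \<in> edges G"
  shows "qvec e \<noteq> 0"
proof -
  have "pairing (\<lambda>c. if c = (t e, False) then 1 else 0) (qvec e) \<noteq> 0"
    using s_neq_t[OF assms] by (simp add: qvec_def linear_diff[OF linear_pairing])
  then show ?thesis
    using linear_0[OF linear_pairing] by metis
qed

text \<open>Modulo the planes, a fixed combination (\<alpha>, \<beta>) of the vertical and the
  horizontal unit vector has the same class at all points of \<open>H\<close>, because an edge
  between points contributes both differences. So \<open>H\<close> accounts for at most two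
  dimensions. An anchor \<xi> kills the combination (1, -\<xi>), and two distinct anchors kill
  everything; \<open>D\<close> holds what is still missing at one point.\<close>

lemma component_generators:
  assumes F: "F \<subseteq> edges G" and H: "H \<in> comps F"
  obtains D where "finite D" "int (card D) \<le> max 0 (2 - int (card (anchors F H)))"
    "\<And>v b. v \<in> verts H \<Longrightarrow> unit_vec (v, b) \<in> span (pvec ` F \<union> qvec ` F \<union> unit_vec ` D)"
proof -
  note generators = that
  obtain i where i: "i \<in> verts H"
    using H component_nonempty unfolding comps_def by blast
  define T where "T D = span (pvec ` F \<union> qvec ` F \<union> unit_vec ` D)" for D :: "('v \<times> bool) set"
  define pt where "pt \<alpha> \<beta> v = \<alpha> *\<^sub>R unit_vec (v, True) + \<beta> *\<^sub>R unit_vec (v, False)"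
    for \<alpha> \<beta> and v :: 'v
  have transport: "pt \<alpha> \<beta> v \<in> T D" if uv: "u \<in> verts H" "v \<in> verts H" and u: "pt \<alpha> \<beta> u \<in> T D" for \<alpha> \<beta> u v D
    using H F uv u
  proof (rule comps_induct)
    fix e assume e: "e \<in> F" "t e \<in> VP"
    have "\<alpha> *\<^sub>R pvec e + \<beta> *\<^sub>R qvec e \<in> T D"
      unfolding T_def using e by (intro span_add span_scale span_base) auto
    moreover have "\<alpha> *\<^sub>R pvec e + \<beta> *\<^sub>R qvec e = pt \<alpha> \<beta> (s e) - pt \<alpha> \<beta> (t e)"
      using e by (simp add: pvec_def qvec_def pt_def algebra_simps)
    ultimately have *: "pt \<alpha> \<beta> (s e) - pt \<alpha> \<beta> (t e) \<in> T D" by simp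
    show "pt \<alpha> \<beta> (s e) \<in> T D \<longleftrightarrow> pt \<alpha> \<beta> (t e) \<in> T D"
    proof
      assume "pt \<alpha> \<beta> (s e) \<in> T D"
      then have "pt \<alpha> \<beta> (s e) - (pt \<alpha> \<beta> (s e) - pt \<alpha> \<beta> (t e)) \<in> T D"
        using * unfolding T_def by (rule span_diff)
      then show "pt \<alpha> \<beta> (t e) \<in> T D" by simp
    next
      assume "pt \<alpha> \<beta> (t e) \<in> T D"
      then have "pt \<alpha> \<beta> (t e) + (pt \<alpha> \<beta> (s e) - pt \<alpha> \<beta> (t e)) \<in> T D"
        using * unfolding T_def by (intro span_add)
      then show "pt \<alpha> \<beta> (s e) \<in> T D" by simp
    qed
  qed
  have anchor: "pt 1 (- \<xi>) i \<in> T D" if "\<xi> \<in> anchors F H" for \<xi> D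
  proof -
    obtain e where e: "e \<in> F" "s e \<in> verts H" "t e \<in> VL" "\<xi> = x (t e)"
      using \<open>\<xi> \<in> anchors F H\<close> anchors_iff[OF F H] by blast
    then have "s e \<in> VP" "t e \<notin> VP"
      using in_comps_subset[OF H] disjoint by blast+
    then have "pt 1 (- \<xi>) (s e) = pvec e"
      using e by (simp add: pt_def pvec_def)
    then have "pt 1 (- \<xi>) (s e) \<in> T D"
      using e unfolding T_def by (intro span_base) auto
    then show ?thesis
      using transport e i by blast
  qed
  have conclude: thesis
    if "finite D" "int (card D) \<le> max 0 (2 - int (card (anchors F H)))"
      and "pt 1 0 i \<in> T D" "pt 0 1 i \<in> T D" for D
  proof (rule generators)
    fix v b assume "v \<in> verts H"
    then have "pt 1 0 v \<in> T D" "pt 0 1 v \<in> T D"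
      using \<open>pt 1 0 i \<in> T D\<close> \<open>pt 0 1 i \<in> T D\<close> transport i by blast+
    then show "unit_vec (v, b) \<in> span (pvec ` F \<union> qvec ` F \<union> unit_vec ` D)"
      by (cases b) (simp_all add: pt_def T_def)
  qed (use that in auto)
  have combine: "pt (a * \<alpha> + b * \<alpha>') (a * \<beta> + b * \<beta>') i \<in> T D"
    if "pt \<alpha> \<beta> i \<in> T D" "pt \<alpha>' \<beta>' i \<in> T D" for a b \<alpha> \<beta> \<alpha>' \<beta>' D
  proof -
    have "a *\<^sub>R pt \<alpha> \<beta> i + b *\<^sub>R pt \<alpha>' \<beta>' i \<in> T D"
      using that unfolding T_def by (intro span_add span_scale)
    then show ?thesis
      by (simp add: pt_def algebra_simps)
  qed
  have base: "c \<in> D \<Longrightarrow> unit_vec c \<in> T D" for c D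
    unfolding T_def by (intro span_base) auto
  consider "card (anchors F H) = 0" | "card (anchors F H) = 1" | "card (anchors F H) \<ge> 2"
    by linarith
  then show thesis
  proof cases
    case 1
    then show thesis
      by (intro conclude[of "{(i, True), (i, False)}"]) (auto simp: pt_def base card_insert_if)
  next
    case 2
    then obtain \<xi> where \<xi>: "\<xi> \<in> anchors F H"
      by (metis card_1_singletonE insertI1)
    have "pt 0 1 i \<in> T {(i, False)}"
      by (simp add: pt_def base)
    then show thesis
      using combine[OF anchor[OF \<xi>], of 0 1 "{(i, False)}" 1 \<xi>] 2
      by (intro conclude[of "{(i, False)}"]) auto
  next
    case 3
    then have "\<not> card (anchors F H) \<le> Suc 0"
      by simp
    then obtain \<xi> \<eta> where \<xi>: "\<xi> \<in> anchors F H" "\<eta> \<in> anchors F H" "\<xi> \<noteq> \<eta>"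
      unfolding card_le_Suc0_iff_eq[OF finite_anchors[OF F H]] by blast
    \<comment> \<open>Subtracting the relation (1, -\<eta>) from (1, -\<xi>) and scaling by
      \<open>r\<close> gives (0, 1).\<close>
    define r where "r = 1 / (\<eta> - \<xi>)"
    have "r * 1 + (- r) * 1 = 0" "r * (- \<xi>) + (- r) * (- \<eta>) = 1"
      using \<xi>(3) by (simp_all add: r_def divide_simps)
    then have "pt 0 1 i \<in> T {}"
      using combine[OF anchor[OF \<xi>(1)] anchor[OF \<xi>(2)], of r "- r" "{}"] by metis
    moreover from this have "pt 1 0 i \<in> T {}"
      using combine[OF anchor[OF \<xi>(1)], of 0 1 "{}" 1 \<xi>] by simp
    ultimately show thesis
      using 3 by (intro conclude[of "{}"]) auto
  qed
qed

text \<open>Completed by the generators of all components, the planes span every coordinate met by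
  \<open>F\<close>, and at most \<open>deficit F\<close> vectors are added. Slider coordinates need
  no completion: each is \<open>qvec\<close> or \<open>pvec\<close> of an incident edge.\<close>

lemma dim_planes:
  assumes F: "F \<subseteq> edges G"
  shows "int (card (coords (\<Union>F))) - deficit F \<le> int (dim (pvec ` F \<union> qvec ` F))"
proof -
  have finF: "finite F"
    using F finite_edges finite_subset by blast
  have "\<forall>H\<in>comps F. \<exists>D. finite D \<and> int (card D) \<le> max 0 (2 - int (card (anchors F H))) \<and>
     (\<forall>v\<in>verts H. \<forall>b. unit_vec (v, b) \<in> span (pvec ` F \<union> qvec ` F \<union> unit_vec ` D))"
    using component_generators[OF F] by metis
  from bchoice[OF this] obtain D where D:
    "\<forall>H\<in>comps F. finite (D H) \<and> int (card (D H)) \<le> max 0 (2 - int (card (anchors F H))) \<and>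
     (\<forall>v\<in>verts H. \<forall>b. unit_vec (v, b) \<in> span (pvec ` F \<union> qvec ` F \<union> unit_vec ` D H))"
    by blast
  define DD where "DD = (\<Union>H\<in>comps F. D H)"
  have "int (card DD) \<le> int (\<Sum>H\<in>comps F. card (D H))"
    unfolding DD_def using card_UN_le[OF finite_comps, of D] by (simp only: of_nat_le_iff)
  also have "\<dots> \<le> deficit F"
    unfolding deficit_def of_nat_sum using D by (intro sum_mono) blast
  finally have cardDD: "int (card DD) \<le> deficit F" .
  have finDD: "finite DD"
    unfolding DD_def using D finite_comps by blast
  have "unit_vec c \<in> span (pvec ` F \<union> qvec ` F \<union> unit_vec ` DD)" if "c \<in> coords (\<Union>F)" for c
  proof (cases "fst c \<in> VP")
    case True
    obtain v b where c: "c = (v, b)"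
      by (cases c)
    then have "v \<in> \<Union>F" "v \<in> VP"
      using that True by (simp_all add: coords_iff)
    then obtain H where H: "H \<in> comps F" "v \<in> verts H"
      by (rule ex_comps)
    then have "unit_vec c \<in> span (pvec ` F \<union> qvec ` F \<union> unit_vec ` D H)"
      using D c by blast
    moreover have "pvec ` F \<union> qvec ` F \<union> unit_vec ` D H \<subseteq> pvec ` F \<union> qvec ` F \<union> unit_vec ` DD"
      using H(1) by (auto simp: DD_def)
    ultimately show ?thesis
      using span_mono by blast
  next
    case False
    obtain v b where c: "c = (v, b)"
      by (cases c)
    then have v: "c = (v, False)" "v \<in> VL" "v \<in> \<Union>F"
      using that False by (simp_all add: coords_iff)
    then obtain e where e: "e \<in> F" "v \<in> e" by blast
    have "e = {s e, t e}" "e \<in> edges G"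
      using e(1) F ends by blast+
    from this(2) have "unit_vec c \<in> pvec ` F \<union> qvec ` F"
    proof (cases rule: edge_cases)
      case PP
      then show ?thesis
        using v(2) e(2) \<open>e = {s e, t e}\<close> by (metis insertE singletonD)
    next
      case PL
      then have "v = t e"
        using v(2) e(2) \<open>e = {s e, t e}\<close> by (metis insertE singletonD)
      then have "unit_vec c = qvec e"
        using PL v(1) by (simp add: qvec_def)
      then show ?thesis using e(1) by blast
    next
      case LL
      then have "v = t e \<or> v = s e"
        using e(2) \<open>e = {s e, t e}\<close> by (metis insertE singletonD)
      then have "unit_vec c = qvec e \<or> unit_vec c = pvec e"
        using LL v(1) by (auto simp: qvec_def pvec_def)
      then show ?thesis using e(1) by blast
    qed
    then show ?thesis
      by (intro span_base) blast
  qed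
  then have "dim (unit_vec ` coords (\<Union>F)) \<le> dim (pvec ` F \<union> qvec ` F \<union> unit_vec ` DD)"
    using finF finDD by (intro dim_mono_finite) auto
  also have "\<dots> \<le> dim (pvec ` F \<union> qvec ` F) + card (unit_vec ` DD)"
    using finF finDD by (intro dim_Un_finite_le) auto
  finally show ?thesis
    using cardDD by (simp add: dim_eq_card_independent[OF independent_unit_vec] card_unit_vec_image)
qed

text \<open>
  The projective change of coordinates that linearises the edge constraints: points are placed at
  \<open>(A / B, 1 / B)\<close> with \<open>(B, A)\<close> the entries of the normal \<open>h\<close> at the two coordinates of the point,
  and a velocity \<open>(u, w)\<close> of the point is recorded as \<open>(B u, A u + w)\<close>.
\<close>

definition place :: "(('v \<times> bool \<Rightarrow>\<^sub>0 real) \<Rightarrow> real) \<Rightarrow> 'v \<Rightarrow> real^2" where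
  "place h v = (if v \<in> VP
     then vector [h (unit_vec (v, True)) / h (unit_vec (v, False)), 1 / h (unit_vec (v, False))]
     else vector [x v, 0])"

section \<open>From normals to placements\<close>

text \<open>Up to a nonzero factor, the bar constraint is the minor
  \<open>h (qvec e) * \<phi> (pvec e) - h (pvec e) * \<phi> (qvec e)\<close>, that is, the value of
  \<phi> at a vector of the plane killed by \<open>h\<close>. As \<open>h (qvec e)\<close> is
  nonzero, this vector is a nonzero multiple of
  \<open>pvec e + \<tau> *\<^sub>R qvec e\<close>.\<close>

lemma place_edge_iff:
  assumes e: "e \<in> edges G" and LL: "s e \<in> VL \<Longrightarrow> t e \<in> VL \<Longrightarrow> x (s e) \<noteq> x (t e)"
    and h: "linear h" "\<And>v. v \<in> VP \<union> VL \<Longrightarrow> h (unit_vec (v, False)) \<noteq> 0"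
    and y: "h (qvec e) \<noteq> 0" "h (pvec e + \<tau> *\<^sub>R qvec e) = 0"
    and \<phi>: "linear \<phi>" "\<And>v. v \<in> VP \<union> VL \<Longrightarrow> \<phi> (unit_vec (v, False)) = h (unit_vec (v, False)) * q v $ 1"
      "\<And>v. v \<in> VP \<Longrightarrow> \<phi> (unit_vec (v, True)) = h (unit_vec (v, True)) * q v $ 1 + q v $ 2"
      "\<And>v. v \<in> VL \<Longrightarrow> q v $ 2 = 0"
  shows "(place h (s e) - place h (t e)) \<bullet> (q (s e) - q (t e)) = 0 \<longleftrightarrow>
         \<phi> (pvec e + \<tau> *\<^sub>R qvec e) = 0"
proof -
  note lin = linear_add[OF h(1)] linear_scale[OF h(1)] linear_diff[OF h(1)]
    linear_add[OF \<phi>(1)] linear_scale[OF \<phi>(1)] linear_diff[OF \<phi>(1)]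
  have "\<exists>\<kappa>. \<kappa> \<noteq> 0 \<and> h (qvec e) * \<phi> (pvec e) - h (pvec e) * \<phi> (qvec e) =
      \<kappa> * ((place h (s e) - place h (t e)) \<bullet> (q (s e) - q (t e)))"
    using e
  proof (cases rule: edge_cases)
    case PP
    then have "h (unit_vec (s e, False)) \<noteq> 0" "h (unit_vec (t e, False)) \<noteq> 0"
      using h(2) by blast+
    then show ?thesis
      using PP \<phi>(2,3)
      by (intro exI[of _ "- h (unit_vec (s e, False)) * h (unit_vec (t e, False))"])
        (simp add: pvec_def qvec_def lin place_def inner_vec_def sum_2 field_simps)
  next
    case PL
    then have "h (unit_vec (s e, False)) \<noteq> 0" "h (unit_vec (t e, False)) \<noteq> 0"
      using h(2) by blast+
    then show ?thesis
      using PL \<phi>(2-4)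
      by (intro exI[of _ "h (unit_vec (s e, False)) * h (unit_vec (t e, False))"])
        (simp add: pvec_def qvec_def lin place_def inner_vec_def sum_2 field_simps)
  next
    case LL': LL
    then have "h (unit_vec (s e, False)) \<noteq> 0" "h (unit_vec (t e, False)) \<noteq> 0" "x (s e) - x (t e) \<noteq> 0"
      using h(2) LL by auto
    \<comment> \<open>The bar contributes \<open>x (s e) - x (t e)\<close> times the difference of
      the horizontal velocities. The factor divides by it, and here adjacent sliders need distinct
      positions.\<close>
    then show ?thesis
      using LL' \<phi>(2-4)
      by (intro exI[of _ "h (unit_vec (s e, False)) * h (unit_vec (t e, False)) / (x (s e) - x (t e))"])
        (simp add: pvec_def qvec_def lin place_def inner_vec_def sum_2 field_simps)
  qed
  moreover have "h (pvec e) = - \<tau> * h (qvec e)"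
    using y(2) by (simp add: lin)
  then have "h (qvec e) * \<phi> (pvec e) - h (pvec e) * \<phi> (qvec e) = h (qvec e) * \<phi> (pvec e + \<tau> *\<^sub>R qvec e)"
    by (simp add: lin algebra_simps)
  ultimately show ?thesis
    using y(1) by (metis mult_eq_0_iff)
qed

text \<open>By the edge count, the chosen vectors span a hyperplane of the coordinate space, with
  normal \<open>h\<close>. So any vector of that space outside the hyperplane completes them to a
  spanning set, and \<open>h\<close> cannot vanish at it.\<close>

lemma generic_normal:
  assumes VL: "VL \<noteq> {}" and card: "card (edges G) + 1 = card (coords UNIV)"
    and count: "\<And>F. F \<subseteq> edges G \<Longrightarrow> F \<noteq> {} \<Longrightarrow>
      int (card F) + 1 + deficit F \<le> int (card (coords (\<Union>F)))"
  obtains \<tau> and h :: "('v \<times> bool \<Rightarrow>\<^sub>0 real) \<Rightarrow> real" where "linear h"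
    "independent ((\<lambda>e. pvec e + \<tau> e *\<^sub>R qvec e) ` edges G)"
    "inj_on (\<lambda>e. pvec e + \<tau> e *\<^sub>R qvec e) (edges G)"
    "\<And>e. e \<in> edges G \<Longrightarrow> h (pvec e + \<tau> e *\<^sub>R qvec e) = 0" "\<And>e. e \<in> edges G \<Longrightarrow> h (qvec e) \<noteq> 0"
    "\<And>v. v \<in> VP \<union> VL \<Longrightarrow> h (unit_vec (v, False)) \<noteq> 0"
    "\<And>v. v \<in> VP \<union> VL \<Longrightarrow> unit_vec ` coords UNIV \<subseteq>
      span (insert (unit_vec (v, False)) ((\<lambda>e. pvec e + \<tau> e *\<^sub>R qvec e) ` edges G))"
proof -
  define C :: "('v \<times> bool) set" where "C = coords UNIV"
  \<comment> \<open>These are the vectors at which \<open>h\<close> must not vanish: the horizontal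
    coordinates, which scale the recorded velocities and by which \<open>place\<close> divides, and
    each \<open>qvec e\<close>, since a normal killing both \<open>qvec e\<close> and
    \<open>y e\<close> would kill the whole plane and make the ends of a point edge
    coincide.\<close>
  define S where "S = qvec ` edges G \<union> (\<lambda>v. unit_vec (v, False)) ` (VP \<union> VL)"
  have nonzero: "w \<notin> span {}" if "w \<in> S" for w
    using that qvec_nonzero by (auto simp: S_def unit_vec_nonzero)
  have S_span: "w \<in> span (unit_vec ` C)" if "w \<in> S" for w
  proof -
    have "unit_vec (v, False) \<in> span (unit_vec ` C)" if "v \<in> VP \<union> VL" for v
      using that by (intro span_base imageI) (simp add: C_def coords_iff)
    then show ?thesis
      using that pvec_qvec_in_span by (auto simp: S_def C_def)
  qed
  have "card F + 1 \<le> dim (pvec ` F \<union> qvec ` F)" if "F \<subseteq> edges G" "F \<noteq> {}" for F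
    using dim_planes[OF that(1)] count[OF that] by linarith
  moreover have "finite S"
    using finite_edges finite_VP finite_VL by (simp add: S_def)
  moreover have dim0: "dim ({} :: ('v \<times> bool \<Rightarrow>\<^sub>0 real) set) = 0"
    using dim_eq_card_independent[OF independent_empty] by simp
  ultimately have "\<exists>\<tau>. (\<forall>w\<in>S. w \<notin> span ({} \<union> (\<lambda>e. pvec e + \<tau> e *\<^sub>R qvec e) ` edges G)) \<and>
      dim ({} \<union> (\<lambda>e. pvec e + \<tau> e *\<^sub>R qvec e) ` edges G) =
      dim ({} :: ('v \<times> bool \<Rightarrow>\<^sub>0 real) set) + card (edges G)"
    using nonzero finite_edges by (intro independent_transversal) simp_all
  then obtain \<tau> where \<tau>: "\<forall>w\<in>S. w \<notin> span ((\<lambda>e. pvec e + \<tau> e *\<^sub>R qvec e) ` edges G)"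
      "dim ((\<lambda>e. pvec e + \<tau> e *\<^sub>R qvec e) ` edges G) = card (edges G)"
    unfolding dim0 Un_empty_left add_0 by blast
  define y where "y e = pvec e + \<tau> e *\<^sub>R qvec e" for e
  have indep: "independent (y ` edges G)" and inj: "inj_on y (edges G)"
    using independent_image_if_dim_eq_card[OF finite_edges] \<tau>(2) unfolding y_def by blast+
  have notin: "w \<notin> span (y ` edges G)" if "w \<in> S" for w
    using that \<tau>(1) unfolding y_def by blast
  have spanning: "unit_vec ` C \<subseteq> span (insert w (y ` edges G))" if w: "w \<in> S" for w
  proof (rule spanning_if_independent_card)
    show "finite (unit_vec ` C)"
      by (simp add: C_def finite_coords)
    show "independent (insert w (y ` edges G))"
      using notin[OF w] indep by (rule independent_insertI)
    have "y e \<in> span (unit_vec ` C)" if "e \<in> edges G" for e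
      unfolding y_def C_def using pvec_qvec_in_span[OF that] by (intro span_add span_scale)
    then show "insert w (y ` edges G) \<subseteq> span (unit_vec ` C)"
      using S_span[OF w] by blast
    have "w \<notin> y ` edges G"
      using notin[OF w] span_base[of w "y ` edges G"] by blast
    then have "card (insert w (y ` edges G)) = card (edges G) + 1"
      using finite_edges card_image[OF inj] by simp
    then show "card (unit_vec ` C) \<le> card (insert w (y ` edges G))"
      using card by (simp add: card_unit_vec_image C_def)
  qed
  obtain j where j: "j \<in> VL"
    using VL by blast
  then have jS: "unit_vec (j, False) \<in> S"
    by (auto simp: S_def)
  obtain h :: "('v \<times> bool \<Rightarrow>\<^sub>0 real) \<Rightarrow> real" where h: "linear h"
    "\<And>z. z \<in> y ` edges G \<Longrightarrow> h z = 0" "h (unit_vec (j, False)) = 1"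
    using separating_functional[OF notin[OF jS]] by blast
  \<comment> \<open>If \<open>h\<close> vanished at \<open>w\<close>, it would vanish at all
    coordinates, against its value 1 at the slider \<open>j\<close>.\<close>
  have hS: "h w \<noteq> 0" if w: "w \<in> S" for w
  proof
    assume "h w = 0"
    then have "h z = 0" if "z \<in> insert w (y ` edges G)" for z
      using h(2) that by auto
    moreover have "unit_vec (j, False) \<in> unit_vec ` C"
      using j by (intro imageI) (simp add: C_def coords_iff)
    ultimately have "h (unit_vec (j, False)) = 0"
      using linear_eq_0_on_span[OF h(1)] spanning[OF w] by blast
    then show False
      using h(3) by simp
  qed
  show thesis
  proof (rule that[of h \<tau>])
    show "h (qvec e) \<noteq> 0" if "e \<in> edges G" for e
      using that hS by (auto simp: S_def)
    show "h (unit_vec (v, False)) \<noteq> 0" if "v \<in> VP \<union> VL" for v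
      using that hS by (auto simp: S_def)
    show "unit_vec ` coords UNIV \<subseteq>
        span (insert (unit_vec (v, False)) ((\<lambda>e. pvec e + \<tau> e *\<^sub>R qvec e) ` edges G))"
      if "v \<in> VP \<union> VL" for v
      using that spanning[of "unit_vec (v, False)"] by (auto simp: S_def C_def y_def)
  qed (use h indep inj[unfolded y_def[abs_def]] in \<open>auto simp: y_def\<close>)
qed

lemma rigid_placement:
  assumes VL: "VL \<noteq> {}" and card: "card (edges G) + 1 = card (coords UNIV)"
    and LL: "\<And>e. e \<in> edges G \<Longrightarrow> s e \<in> VL \<Longrightarrow> t e \<in> VL \<Longrightarrow> x (s e) \<noteq> x (t e)"
    and count: "\<And>F. F \<subseteq> edges G \<Longrightarrow> F \<noteq> {} \<Longrightarrow>
      int (card F) + 1 + deficit F \<le> int (card (coords (\<Union>F)))"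
  shows "\<exists>p. minimally_infinitesimally_rigid G VL p \<and> (\<forall>i\<in>VL. p i = vector [x i, 0])"
proof (rule generic_normal[OF VL card])
  show "int (card F) + 1 + deficit F \<le> int (card (coords (\<Union>F)))" if "F \<subseteq> edges G" "F \<noteq> {}" for F
    using count that .
next
  fix \<tau> and h :: "('v \<times> bool \<Rightarrow>\<^sub>0 real) \<Rightarrow> real"
  assume h: "linear h"
    and indep: "independent ((\<lambda>e. pvec e + \<tau> e *\<^sub>R qvec e) ` edges G)"
    and inj: "inj_on (\<lambda>e. pvec e + \<tau> e *\<^sub>R qvec e) (edges G)"
    and hy: "\<And>e. e \<in> edges G \<Longrightarrow> h (pvec e + \<tau> e *\<^sub>R qvec e) = 0"
    and hq: "\<And>e. e \<in> edges G \<Longrightarrow> h (qvec e) \<noteq> 0"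
    and hu: "\<And>v. v \<in> VP \<union> VL \<Longrightarrow> h (unit_vec (v, False)) \<noteq> 0"
    and spanning: "\<And>v. v \<in> VP \<union> VL \<Longrightarrow> unit_vec ` coords UNIV \<subseteq>
      span (insert (unit_vec (v, False)) ((\<lambda>e. pvec e + \<tau> e *\<^sub>R qvec e) ` edges G))"
  define y where "y e = pvec e + \<tau> e *\<^sub>R qvec e" for e
  have edge_iff: "(place h (s e) - place h (t e)) \<bullet> (q (s e) - q (t e)) = 0 \<longleftrightarrow> \<phi> (y e) = 0"
    if "e \<in> edges G" "linear \<phi>"
      "\<And>v. v \<in> VP \<union> VL \<Longrightarrow> \<phi> (unit_vec (v, False)) = h (unit_vec (v, False)) * q v $ 1"
      "\<And>v. v \<in> VP \<Longrightarrow> \<phi> (unit_vec (v, True)) = h (unit_vec (v, True)) * q v $ 1 + q v $ 2"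
      "\<And>v. v \<in> VL \<Longrightarrow> q v $ 2 = 0" for e q \<phi>
    unfolding y_def using that place_edge_iff[OF that(1) LL[OF that(1)] h hu hq[OF that(1)] hy[OF that(1)]] by blast
  obtain j where j: "j \<in> VL"
    using VL by blast
  have "infinitesimally_rigid G VL (place h)"
    unfolding infinitesimally_rigid_def
  proof (intro allI impI)
    fix q assume "infinitesimal_motion G VL (place h) q"
    then have q: "\<And>e. e \<in> edges G \<Longrightarrow> (place h (s e) - place h (t e)) \<bullet> (q (s e) - q (t e)) = 0"
        "\<And>v. v \<in> VL \<Longrightarrow> q v $ 2 = 0"
      by (auto simp: infinitesimal_motion_iff)
    define m where "m = (\<lambda>(v, b). if b then h (unit_vec (v, True)) * q v $ 1 + q v $ 2
      else h (unit_vec (v, False)) * q v $ 1)"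
    have m: "m (v, True) = h (unit_vec (v, True)) * q v $ 1 + q v $ 2"
        "m (v, False) = h (unit_vec (v, False)) * q v $ 1" for v
      by (simp_all add: m_def)
    define c where "c = q j $ 1"
    \<comment> \<open>Here \<open>c * h\<close> records the horizontal translation with the velocity
      of \<open>j\<close>. Once it is subtracted, the functional vanishes at
      \<open>(j, False)\<close> as well, hence on a spanning set.\<close>
    define \<psi> where "\<psi> f = pairing m f - c * h f" for f
    have "linear \<psi>"
      unfolding \<psi>_def using linear_compose_sub[OF linear_pairing, of "\<lambda>f. c * h f" m] linear_compose_scale_right[OF h, of c]
      by simp
    moreover have "\<psi> f = 0" if "f \<in> insert (unit_vec (j, False)) (y ` edges G)" for f
    proof -
      have "pairing m (y e) = 0" if "e \<in> edges G" for e
        using that q edge_iff[OF that linear_pairing, of m q] by (simp add: m)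
      then show ?thesis
        using that hy by (auto simp: \<psi>_def y_def m c_def)
    qed
    ultimately have "\<psi> (unit_vec d) = 0" if "d \<in> coords UNIV" for d
      using spanning[of j] j that linear_eq_0_on_span unfolding y_def by blast
    then have *: "m d = c * h (unit_vec d)" if "d \<in> coords UNIV" for d
      using that by (simp add: \<psi>_def)
    have "q v = vector [c, 0]" if v: "v \<in> VP \<union> VL" for v
    proof -
      have "q v $ 1 = c"
        using *[of "(v, False)"] v hu[OF v] by (simp add: coords_iff m)
      moreover have "q v $ 2 = 0"
        using *[of "(v, True)"] v q(2)[of v] \<open>q v $ 1 = c\<close> by (cases "v \<in> VL") (simp_all add: coords_iff m)
      ultimately show ?thesis
        by (simp add: vec_eq_iff forall_2)
    qed
    then show "horizontal_translation G q"
      unfolding horizontal_translation_def verts_G by blast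
  qed
  moreover have "\<not> infinitesimally_rigid (delete_edge G e) VL (place h)" if e: "e \<in> edges G" for e
  proof
    assume rigid: "infinitesimally_rigid (delete_edge G e) VL (place h)"
    have "y ` edges G - {y e} = y ` (edges G - {e})"
      using inj e unfolding y_def[abs_def] by (auto simp: inj_on_def)
    moreover have "independent (y ` edges G)"
      unfolding y_def[abs_def] by (rule indep)
    then have "y e \<notin> span (y ` edges G - {y e})"
      using e unfolding dependent_def by blast
    ultimately have "y e \<notin> span (y ` (edges G - {e}))"
      by simp
    then obtain \<phi> :: "('v \<times> bool \<Rightarrow>\<^sub>0 real) \<Rightarrow> real" where \<phi>: "linear \<phi>"
      "\<And>z. z \<in> y ` (edges G - {e}) \<Longrightarrow> \<phi> z = 0" "\<phi> (y e) = 1"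
      using separating_functional by blast
    \<comment> \<open>The recording of velocities is inverted. The functional that vanishes on all
      chosen vectors except \<open>y e\<close> becomes a motion violating the bar \<open>e\<close>
      alone, which no translation does.\<close>
    define u where "u v = \<phi> (unit_vec (v, False)) / h (unit_vec (v, False))" for v
    define q :: "'v \<Rightarrow> real^2" where
      "q v = vector [u v, if v \<in> VP then \<phi> (unit_vec (v, True)) - h (unit_vec (v, True)) * u v else 0]" for v
    have q: "\<phi> (unit_vec (v, False)) = h (unit_vec (v, False)) * q v $ 1" if "v \<in> VP \<union> VL" for v
      using hu[OF that] by (simp add: q_def u_def)
    have q': "\<phi> (unit_vec (v, True)) = h (unit_vec (v, True)) * q v $ 1 + q v $ 2" if "v \<in> VP" for v
      using that by (simp add: q_def)
    have q'': "q v $ 2 = 0" if "v \<in> VL" for v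
      using that disjoint by (auto simp: q_def)
    have iff: "(place h (s f) - place h (t f)) \<bullet> (q (s f) - q (t f)) = 0 \<longleftrightarrow> \<phi> (y f) = 0"
      if "f \<in> edges G" for f
      using edge_iff[OF that \<phi>(1) q q' q''] by blast
    have "infinitesimal_motion (delete_edge G e) VL (place h) q"
      using iff \<phi>(2) q'' by (simp add: infinitesimal_motion_delete_edge_iff)
    then obtain c where "\<forall>v\<in>VP \<union> VL. q v = vector [c, 0]"
      using rigid by (auto simp: infinitesimally_rigid_def horizontal_translation_def delete_edge_def verts_G)
    moreover have "s e \<in> VP \<union> VL" "t e \<in> VP \<union> VL"
      using e by (cases rule: edge_cases; blast)+
    ultimately have "q (s e) = q (t e)"
      by metis
    then show False
      using iff[OF e] \<phi>(3) by simp
  qed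
  moreover have "\<forall>i\<in>VL. place h i = vector [x i, 0]"
    using disjoint by (auto simp: place_def)
  ultimately show ?thesis
    unfolding minimally_infinitesimally_rigid_def by blast
qed

section \<open>Necessity\<close>

text \<open>The columns of the vertical slider coordinates are dropped, so a functional on these
  vectors satisfies the slider conditions automatically when read as a velocity field.\<close>

definition edge_row :: "('v \<Rightarrow> real^2) \<Rightarrow> 'v set \<Rightarrow> ('v \<times> bool) \<Rightarrow>\<^sub>0 real" where
  "edge_row p e = (p (s e) $ 1 - p (t e) $ 1) *\<^sub>R (unit_vec (s e, False) - unit_vec (t e, False)) +
     (p (s e) $ 2 - p (t e) $ 2) *\<^sub>R ((if s e \<in> VP then unit_vec (s e, True) else 0) -
       (if t e \<in> VP then unit_vec (t e, True) else 0))"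

definition velocity :: "(('v \<times> bool \<Rightarrow>\<^sub>0 real) \<Rightarrow> real) \<Rightarrow> 'v \<Rightarrow> real^2" where
  "velocity \<phi> v = vector [\<phi> (unit_vec (v, False)), if v \<in> VP then \<phi> (unit_vec (v, True)) else 0]"

lemma functional_row:
  assumes "linear \<phi>"
  shows "\<phi> (edge_row p e) = (p (s e) - p (t e)) \<bullet> (velocity \<phi> (s e) - velocity \<phi> (t e))"
  by (simp add: edge_row_def velocity_def linear_add[OF assms] linear_diff[OF assms] linear_scale[OF assms]
      linear_0[OF assms] inner_vec_def sum_2)

lemma velocity_pairing:
  assumes "\<And>v. v \<in> VL \<Longrightarrow> q v $ 2 = 0" "v \<in> VP \<union> VL"
  shows "velocity (pairing (\<lambda>(v, b). q v $ (if b then 2 else 1))) v = q v"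
  using assms by (auto simp: velocity_def vec_eq_iff forall_2)

lemma pairing_row:
  assumes "\<And>v. v \<in> VL \<Longrightarrow> q v $ 2 = 0" "e \<in> edges G"
  shows "pairing (\<lambda>(v, b). q v $ (if b then 2 else 1)) (edge_row p e) =
    (p (s e) - p (t e)) \<bullet> (q (s e) - q (t e))"
proof -
  have "s e \<in> VP \<union> VL" "t e \<in> VP \<union> VL"
    using assms(2) by (cases rule: edge_cases; blast)+
  then show ?thesis
    unfolding functional_row[OF linear_pairing] using velocity_pairing[OF assms(1)] by simp
qed

lemma row_in_span:
  assumes "F \<subseteq> edges G" "e \<in> F"
  shows "edge_row p e \<in> span (unit_vec ` coords (\<Union>F))"
proof -
  have "e \<in> edges G" "e = {s e, t e}"
    using assms ends by blast+
  then have "s e \<in> \<Union>F" "t e \<in> \<Union>F"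
    using assms(2) by blast+
  moreover have "s e \<in> VP \<union> VL" "t e \<in> VP \<union> VL"
    using \<open>e \<in> edges G\<close> by (cases rule: edge_cases; blast)+
  ultimately have "(s e, False) \<in> coords (\<Union>F)" "(t e, False) \<in> coords (\<Union>F)"
      "s e \<in> VP \<Longrightarrow> (s e, True) \<in> coords (\<Union>F)" "t e \<in> VP \<Longrightarrow> (t e, True) \<in> coords (\<Union>F)"
    by (auto simp: coords_iff)
  then show ?thesis
    unfolding edge_row_def by (intro span_add span_scale span_diff) (auto intro: span_base span_zero)
qed

text \<open>By minimality the framework without \<open>e\<close> has a motion that is not a
  translation. The full framework is rigid, so this motion violates the bar \<open>e\<close> and no
  other; pairing with it is the dual functional.\<close>

lemma rows_dual:
  assumes min: "minimally_infinitesimally_rigid G VL p" and e: "e \<in> edges G"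
  shows "\<exists>\<phi> :: ('v \<times> bool \<Rightarrow>\<^sub>0 real) \<Rightarrow> real. linear \<phi> \<and> \<phi> (edge_row p e) \<noteq> 0 \<and>
    (\<forall>f\<in>edges G - {e}. \<phi> (edge_row p f) = 0)"
proof -
  obtain q where q: "infinitesimal_motion (delete_edge G e) VL p q"
    and not_translation: "\<not> horizontal_translation (delete_edge G e) q"
    using min e by (auto simp: minimally_infinitesimally_rigid_def infinitesimally_rigid_def)
  have slider: "\<And>v. v \<in> VL \<Longrightarrow> q v $ 2 = 0"
    using q by (simp add: infinitesimal_motion_def)
  have others: "(p (s f) - p (t f)) \<bullet> (q (s f) - q (t f)) = 0" if "f \<in> edges G" "f \<noteq> e" for f
    using q that by (simp add: infinitesimal_motion_delete_edge_iff)
  have "\<not> horizontal_translation G q"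
    using not_translation by (simp add: horizontal_translation_def delete_edge_def)
  then have "\<not> infinitesimal_motion G VL p q"
    using min by (auto simp: minimally_infinitesimally_rigid_def infinitesimally_rigid_def)
  then have "(p (s e) - p (t e)) \<bullet> (q (s e) - q (t e)) \<noteq> 0"
    unfolding infinitesimal_motion_iff using others slider by metis
  then show ?thesis
    using others pairing_row[OF slider, where p = p] e
    by (intro exI[of _ "pairing (\<lambda>(v, b). q v $ (if b then 2 else 1))"]) (simp_all add: linear_pairing)
qed

lemma row_nonzero:
  assumes "minimally_infinitesimally_rigid G VL p" "e \<in> edges G"
  shows "edge_row p e \<noteq> 0"
  using rows_dual[OF assms] linear_0 by metis

lemma ends_distinct:
  assumes "minimally_infinitesimally_rigid G VL p" "e \<in> edges G"
  shows "p (s e) \<noteq> p (t e)"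
  using row_nonzero[OF assms] by (auto simp: edge_row_def)

lemma inj_on_row:
  assumes "minimally_infinitesimally_rigid G VL p"
  shows "inj_on (edge_row p) (edges G)"
proof (rule inj_onI)
  fix e f assume ef: "e \<in> edges G" "f \<in> edges G" "edge_row p e = edge_row p f"
  then show "e = f"
    using rows_dual[OF assms ef(1)] by force
qed

lemma independent_rows:
  assumes "minimally_infinitesimally_rigid G VL p"
  shows "independent (edge_row p ` edges G)"
proof (rule independent_if_dual_functionals)
  fix b assume "b \<in> edge_row p ` edges G"
  then obtain e where e: "e \<in> edges G" "b = edge_row p e" by blast
  have "edge_row p ` edges G - {b} \<subseteq> edge_row p ` (edges G - {e})"
    using e(2) by blast
  then show "\<exists>\<phi> :: ('v \<times> bool \<Rightarrow>\<^sub>0 real) \<Rightarrow> real. linear \<phi> \<and> \<phi> b \<noteq> 0 \<and>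
      (\<forall>c\<in>edge_row p ` edges G - {b}. \<phi> c = 0)"
    using rows_dual[OF assms e(1)] e(2) by blast
qed

lemma translation_row: "pairing (\<lambda>(v, b). if b then 0 else 1) (edge_row p e) = 0"
proof -
  have "linear (pairing (\<lambda>(v :: 'v, b). if b then 0 else 1))"
    by (rule linear_pairing)
  from functional_row[OF this] show ?thesis
    by (simp add: velocity_def)
qed

text \<open>The rows together with one horizontal slider coordinate form a basis of the coordinate
  space. The translation separates that coordinate from the rows, and a functional killing all of
  them is a motion with \<open>j\<close> at rest, hence zero by rigidity.\<close>

lemma card_edges:
  assumes min: "minimally_infinitesimally_rigid G VL p" and j: "j \<in> VL"
  shows "card (edges G) + 1 = card (coords UNIV)"
proof -
  define B where "B = insert (unit_vec (j, False)) (edge_row p ` edges G)"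
  have notin: "unit_vec (j, False) \<notin> span (edge_row p ` edges G)"
    by (rule notin_span_if_functional[OF linear_pairing[of "\<lambda>(v, b). if b then 0 else 1"]])
      (auto simp: translation_row)
  then have indep: "independent B"
    unfolding B_def using independent_rows[OF min] by (rule independent_insertI)
  have cardB: "card B = card (edges G) + 1"
  proof -
    have "unit_vec (j, False) \<notin> edge_row p ` edges G"
      using notin by (auto intro: span_base)
    then show ?thesis
      using finite_edges card_image[OF inj_on_row[OF min]] by (simp add: B_def)
  qed
  have "edge_row p e \<in> span (unit_vec ` coords UNIV)" if "e \<in> edges G" for e
  proof -
    have "coords (\<Union>(edges G)) \<subseteq> coords UNIV"
      by (auto simp: coords_def)
    then show ?thesis
      using row_in_span[of "edges G" e p] that span_mono[OF image_mono] by blast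
  qed
  then have "B \<subseteq> span (unit_vec ` coords UNIV)"
    using j by (auto simp: B_def coords_iff intro: span_base)
  then have upper: "card B \<le> card (unit_vec ` coords UNIV)"
    using independent_span_bound[OF _ indep] finite_coords by blast
  have "unit_vec ` coords UNIV \<subseteq> span B"
  proof (rule ccontr)
    assume "\<not> unit_vec ` coords UNIV \<subseteq> span B"
    then obtain v b where vb: "(v, b) \<in> coords UNIV" "unit_vec (v, b) \<notin> span B"
      by auto
    then obtain \<phi> :: "('v \<times> bool \<Rightarrow>\<^sub>0 real) \<Rightarrow> real" where \<phi>: "linear \<phi>"
      "\<And>z. z \<in> B \<Longrightarrow> \<phi> z = 0" "\<phi> (unit_vec (v, b)) = 1"
      using separating_functional by blast
    have "infinitesimal_motion G VL p (velocity \<phi>)"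
      unfolding infinitesimal_motion_iff functional_row[OF \<phi>(1), symmetric]
      using \<phi>(2) disjoint by (auto simp: B_def velocity_def)
    then obtain c where c: "\<And>w. w \<in> VP \<union> VL \<Longrightarrow> velocity \<phi> w = vector [c, 0]"
      using min verts_G by (auto simp: minimally_infinitesimally_rigid_def infinitesimally_rigid_def
          horizontal_translation_def)
    have "velocity \<phi> j $ 1 = 0"
      using \<phi>(2) by (simp add: velocity_def B_def)
    then have "c = 0"
      using c[of j] j by simp
    have "v \<in> VP \<union> VL"
      using vb(1) by (auto simp: coords_iff)
    then have "velocity \<phi> v $ 1 = 0" "velocity \<phi> v $ 2 = 0"
      using c \<open>c = 0\<close> by simp_all
    then have "\<phi> (unit_vec (v, b)) = 0"
      using vb(1) disjoint by (cases b) (auto simp: velocity_def coords_iff)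
    then show False
      using \<phi>(3) by simp
  qed
  moreover have "finite B"
    using finite_edges by (simp add: B_def)
  ultimately have "card (unit_vec ` coords UNIV) \<le> card B"
    using independent_span_bound[OF _ independent_unit_vec[of "coords UNIV"]] by blast
  then show ?thesis
    using cardB upper by (simp add: card_unit_vec_image)
qed

section \<open>Motions of a single component\<close>

text \<open>The general infinitesimal isometry of the plane, with angular velocity \<kappa> and
  translation part (\<mu>, \<gamma>), applied to \<open>H\<close> while everything else
  rests.\<close>

definition component_motion :: "('v \<Rightarrow> real^2) \<Rightarrow> 'v graph \<Rightarrow> real \<Rightarrow> real \<Rightarrow> real \<Rightarrow> 'v \<times> bool \<Rightarrow> real" where
  "component_motion p H \<kappa> \<mu> \<gamma> = (\<lambda>(v, b). if v \<in> verts H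
     then if b then \<kappa> * p v $ 1 + \<gamma> else \<mu> - \<kappa> * p v $ 2 else 0)"

text \<open>A bar of \<open>F\<close> meeting \<open>H\<close> either lies inside \<open>H\<close>,
  where an isometry preserves it, or ends at a resting slider whose position is an anchor. The last
  hypothesis makes the motion a rotation about that slider, or zero, so the velocity is orthogonal
  to the bar.\<close>

lemma component_motion_row:
  assumes F: "F \<subseteq> edges G" and H: "H \<in> comps F" and e: "e \<in> F"
    and p: "\<And>i. i \<in> VL \<Longrightarrow> p i = vector [x i, 0]"
    and anchored: "\<And>\<xi>. \<xi> \<in> anchors F H \<Longrightarrow> \<mu> = 0 \<and> \<gamma> = - \<kappa> * \<xi>"
  shows "pairing (component_motion p H \<kappa> \<mu> \<gamma>) (edge_row p e) = 0"
proof -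
  have HV: "verts H \<subseteq> VP"
    using in_comps_subset[OF H] by blast
  let ?m = "component_motion p H \<kappa> \<mu> \<gamma>"
  have vel: "velocity (pairing (component_motion p H \<kappa> \<mu> \<gamma>)) v =
      (if v \<in> verts H then vector [\<mu> - \<kappa> * p v $ 2, \<kappa> * p v $ 1 + \<gamma>] else 0)" for v \<mu> \<gamma>
    using HV by (auto simp: velocity_def component_motion_def vec_eq_iff forall_2)
  have "e \<in> edges G"
    using F e by blast
  then show ?thesis
    unfolding functional_row[OF linear_pairing]
  proof (cases rule: edge_cases)
    case PP
    then have "s e \<in> verts H \<longleftrightarrow> t e \<in> verts H"
      using point_edge_in_comps[OF H F e] by blast
    then show "(p (s e) - p (t e)) \<bullet> (velocity (pairing ?m) (s e) - velocity (pairing ?m) (t e)) = 0"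
      by (simp add: vel inner_vec_def sum_2 algebra_simps)
  next
    case PL
    then have t: "t e \<notin> verts H"
      using HV by blast
    show "(p (s e) - p (t e)) \<bullet> (velocity (pairing ?m) (s e) - velocity (pairing ?m) (t e)) = 0"
    proof (cases "s e \<in> verts H")
      case True
      then have "\<mu> = 0 \<and> \<gamma> = - \<kappa> * x (t e)"
        using anchored anchors_iff[OF F H] e PL by blast
      then show ?thesis
        using t True p[OF PL(2)] by (simp add: vel inner_vec_def sum_2 algebra_simps)
    qed (simp add: vel t)
  next
    case LL
    then have "s e \<notin> verts H" "t e \<notin> verts H"
      using HV by blast+
    then show "(p (s e) - p (t e)) \<bullet> (velocity (pairing ?m) (s e) - velocity (pairing ?m) (t e)) = 0"
      by (simp add: vel)
  qed
qed

text \<open>The motion \<open>m\<close> is a certificate: it annihilates every vector present but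
  not the new one, which therefore lies outside their span.\<close>

lemma insert_unit_vec_independent:
  assumes indep: "independent (edge_row p ` F \<union> unit_vec ` D)" and finite: "finite F" "finite D"
    and m: "\<And>e. e \<in> F \<Longrightarrow> pairing m (edge_row p e) = 0" "\<And>d. d \<in> D \<Longrightarrow> m d = 0" "m c \<noteq> 0"
  shows "independent (edge_row p ` F \<union> unit_vec ` insert c D) \<and>
    card (edge_row p ` F \<union> unit_vec ` insert c D) = card (edge_row p ` F \<union> unit_vec ` D) + 1"
proof -
  have notin: "unit_vec c \<notin> span (edge_row p ` F \<union> unit_vec ` D)"
    by (rule notin_span_if_functional[OF linear_pairing[of m]]) (use m in auto)
  have "independent (edge_row p ` F \<union> unit_vec ` insert c D)"
    using independent_insertI[OF notin indep] by simp
  moreover have "unit_vec c \<notin> edge_row p ` F \<union> unit_vec ` D"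
    using notin by (auto intro: span_base)
  ultimately show ?thesis
    using finite by simp
qed

text \<open>
  The coordinates added for a component are those at which its rotations and vertical translations
  can be detected one after the other; \<open>v0\<close> carries the coordinate reserved for the horizontal
  translation.
\<close>

lemma add_component:
  assumes min: "minimally_infinitesimally_rigid G VL p"
    and p: "\<And>i. i \<in> VL \<Longrightarrow> p i = vector [x i, 0]"
    and F: "F \<subseteq> edges G" and H: "H \<in> comps F"
    and v0: "v0 \<in> VL \<or> \<Union>F \<inter> VL = {}"
    and indep: "independent (edge_row p ` F \<union> unit_vec ` D)" and finD: "finite D"
    and D: "D \<inter> verts H \<times> UNIV \<subseteq> {(v0, False)}"
  shows "\<exists>D'. D \<subseteq> D' \<and> D' - D \<subseteq> verts H \<times> UNIV \<and> finite D' \<and>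
    independent (edge_row p ` F \<union> unit_vec ` D') \<and>
    card (edge_row p ` F \<union> unit_vec ` D') =
      card (edge_row p ` F \<union> unit_vec ` D) + (2 - card (anchors F H))"
proof -
  have HV: "verts H \<subseteq> \<Union>F \<inter> VP"
    using in_comps_subset[OF H] .
  have finF: "finite F"
    using F finite_edges finite_subset by blast
  note motion_row = component_motion_row[OF F H _ p]
  have off: "component_motion p H \<kappa> \<mu> \<gamma> d = 0" if "d \<notin> verts H \<times> UNIV" for \<kappa> \<mu> \<gamma> d
    using that by (cases d) (auto simp: component_motion_def)
  consider (free) "card (anchors F H) = 0" | (pinned) "card (anchors F H) = 1" | (fixed) "card (anchors F H) \<ge> 2"
    by linarith
  then show ?thesis
  proof cases
    case free
    then have no_anchors: "anchors F H = {}"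
      using finite_anchors[OF F H] by simp
    \<comment> \<open>If \<open>v0\<close> lies in \<open>H\<close>, it has to be the base point:
      the vertical translation and the rotation about \<open>p i\<close> both vanish at
      \<open>(i, False)\<close>.\<close>
    obtain i where i: "i \<in> verts H" "v0 \<in> verts H \<longrightarrow> i = v0"
      using H component_nonempty unfolding comps_def by metis
    then obtain e where e: "e \<in> F" "i \<in> e"
      using HV by blast
    have eG: "e \<in> edges G" and e_ends: "e = {s e, t e}"
      using e(1) F ends by blast+
    have i_end: "i = s e \<or> i = t e"
      using e(2) e_ends by blast
    have "i \<in> VP"
      using i(1) HV by blast
    \<comment> \<open>Without anchors, the bar at \<open>i\<close> stays inside \<open>H\<close>.
      Its ends have distinct positions, so some point of \<open>H\<close> is moved by the rotation
      about \<open>p i\<close>.\<close>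
    have "t e \<in> VP"
      using eG
    proof (cases rule: edge_cases)
      case PL
      then have "i = s e"
        using i_end \<open>i \<in> VP\<close> by blast
      then have "x (t e) \<in> anchors F H"
        using anchors_iff[OF F H] e(1) i(1) PL(2) by blast
      then show ?thesis
        using no_anchors by simp
    next
      case LL
      then show ?thesis
        using i_end \<open>i \<in> VP\<close> by blast
    qed
    then have "s e \<in> verts H" "t e \<in> verts H"
      using point_edge_in_comps[OF H F e(1)] i(1) i_end by blast+
    then obtain k where k: "k \<in> verts H" "p k \<noteq> p i"
      using ends_distinct[OF min eG] i_end by metis
    \<comment> \<open>The rotation about \<open>p i\<close> vanishes at both coordinates of
      \<open>i\<close>, hence also at \<open>(i, True)\<close>, which is added before it is
      used.\<close>
    let ?rot = "component_motion p H 1 (p i $ 2) (- p i $ 1)"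
    obtain b where b: "?rot (k, b) \<noteq> 0"
    proof -
      have "p k $ 1 \<noteq> p i $ 1 \<or> p k $ 2 \<noteq> p i $ 2"
        using k(2) by (simp add: vec_eq_iff forall_2)
      then have "?rot (k, True) \<noteq> 0 \<or> ?rot (k, False) \<noteq> 0"
        using k(1) by (auto simp: component_motion_def)
      then show thesis
        using that by blast
    qed
    have vanish: "d \<in> D \<Longrightarrow> d \<in> verts H \<times> UNIV \<Longrightarrow> d = (i, False)" for d
      using D i(2) by blast
    have 1: "independent (edge_row p ` F \<union> unit_vec ` insert (i, True) D) \<and>
        card (edge_row p ` F \<union> unit_vec ` insert (i, True) D) = card (edge_row p ` F \<union> unit_vec ` D) + 1"
    proof (rule insert_unit_vec_independent[OF indep finF finD])
      show "pairing (component_motion p H 0 0 1) (edge_row p e) = 0" if "e \<in> F" for e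
        using motion_row[OF that] no_anchors by simp
      show "component_motion p H 0 0 1 d = 0" if "d \<in> D" for d
        using vanish[OF that] off by (cases "d \<in> verts H \<times> UNIV") (auto simp: component_motion_def)
      show "component_motion p H 0 0 1 (i, True) \<noteq> 0"
        using i(1) by (simp add: component_motion_def)
    qed
    have 2: "independent (edge_row p ` F \<union> unit_vec ` insert (k, b) (insert (i, True) D)) \<and>
        card (edge_row p ` F \<union> unit_vec ` insert (k, b) (insert (i, True) D)) =
         card (edge_row p ` F \<union> unit_vec ` insert (i, True) D) + 1"
    proof (rule insert_unit_vec_independent[OF conjunct1[OF 1] finF])
      show "finite (insert (i, True) D)"
        using finD by simp
      show "pairing ?rot (edge_row p e) = 0" if "e \<in> F" for e
        using motion_row[OF that] no_anchors by simp
      have "?rot (i, c) = 0" for c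
        by (simp add: component_motion_def)
      then show "?rot d = 0" if "d \<in> insert (i, True) D" for d
        using that vanish[of d] off by (cases "d \<in> verts H \<times> UNIV") auto
      show "?rot (k, b) \<noteq> 0"
        by (rule b)
    qed
    show ?thesis
      using 1 2 free i(1) k(1) finD
      by (intro exI[of _ "insert (k, b) (insert (i, True) D)"]) auto
  next
    case pinned
    then obtain \<xi> where \<xi>: "anchors F H = {\<xi>}"
      using card_1_singletonE by blast
    then obtain e where e: "e \<in> F" "s e \<in> verts H" "t e \<in> VL" "\<xi> = x (t e)"
      using anchors_iff[OF F H, of \<xi>] by blast
    have "e \<in> edges G" "e = {s e, t e}"
      using e(1) F ends by blast+
    then have "\<Union>F \<inter> VL \<noteq> {}"
      using e(1,3) by blast
    \<comment> \<open>An anchor means that \<open>F\<close> meets a slider, and then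
      \<open>v0\<close> is a slider by hypothesis.\<close>
    then have "v0 \<notin> verts H"
      using v0 HV disjoint by blast
    then have vanish: "d \<in> D \<Longrightarrow> d \<notin> verts H \<times> UNIV" for d
      using D by blast
    \<comment> \<open>This is the rotation about the anchor. It moves \<open>s e\<close>, since the
      ends of the bar \<open>e\<close> have distinct positions.\<close>
    let ?rot = "component_motion p H 1 0 (- \<xi>)"
    have "p (s e) \<noteq> vector [\<xi>, 0]"
      using ends_distinct[OF min \<open>e \<in> edges G\<close>] p[OF e(3)] e(4) by simp
    then have "p (s e) $ 1 \<noteq> \<xi> \<or> p (s e) $ 2 \<noteq> 0"
      by (simp add: vec_eq_iff forall_2)
    then have "?rot (s e, True) \<noteq> 0 \<or> ?rot (s e, False) \<noteq> 0"
      using e(2) by (auto simp: component_motion_def)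
    then obtain b where b: "?rot (s e, b) \<noteq> 0"
      by blast
    have "independent (edge_row p ` F \<union> unit_vec ` insert (s e, b) D) \<and>
        card (edge_row p ` F \<union> unit_vec ` insert (s e, b) D) = card (edge_row p ` F \<union> unit_vec ` D) + 1"
    proof (rule insert_unit_vec_independent[OF indep finF finD])
      show "pairing ?rot (edge_row p e) = 0" if "e \<in> F" for e
        using motion_row[OF that, where \<kappa> = 1 and \<mu> = 0 and \<gamma> = "- \<xi>"] \<xi> by simp
      show "?rot d = 0" if "d \<in> D" for d
        using vanish[OF that] off by blast
      show "?rot (s e, b) \<noteq> 0"
        by (rule b)
    qed
    then show ?thesis
      using pinned e(2) finD by (intro exI[of _ "insert (s e, b) D"]) auto
  next
    case fixed
    then show ?thesis
      using indep finD by (intro exI[of _ D]) auto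
  qed
qed

lemma card_rows_le:
  assumes min: "minimally_infinitesimally_rigid G VL p"
    and p: "\<And>i. i \<in> VL \<Longrightarrow> p i = vector [x i, 0]"
    and F: "F \<subseteq> edges G" "F \<noteq> {}"
  shows "int (card F) + 1 + deficit F \<le> int (card (coords (\<Union>F)))"
proof -
  have finF: "finite F"
    using F finite_edges finite_subset by blast
  \<comment> \<open>A slider is preferred, because the only rotation left to a component with one
    anchor need not vanish at the horizontal coordinate of a point of that component.\<close>
  obtain v0 where v0: "v0 \<in> \<Union>F" "v0 \<in> VL \<or> \<Union>F \<inter> VL = {}"
  proof (cases "\<Union>F \<inter> VL = {}")
    case True
    obtain e where "e \<in> F"
      using F(2) by blast
    then have "s e \<in> \<Union>F"
      using F(1) ends by blast
    then show thesis
      using that True by blast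
  qed (use that in blast)
  have "v0 \<in> VP \<union> VL"
  proof -
    obtain e where "e \<in> F" "v0 \<in> e"
      using v0(1) by blast
    then show ?thesis
      using F(1) point_line by (auto simp: point_line_graph_def simple_graph_def)
  qed
  have "independent (edge_row p ` F)"
    using independent_rows[OF min] F(1) independent_mono image_mono by metis
  then have "independent (edge_row p ` F \<union> unit_vec ` {})"
    by simp
  \<comment> \<open>The horizontal translation detects \<open>(v0, False)\<close>; this is the 1
    added to \<open>card F\<close>.\<close>
  from insert_unit_vec_independent[OF this finF finite.emptyI, of "\<lambda>(v, b). if b then 0 else 1" "(v0, False)"]
  have start: "independent (edge_row p ` F \<union> unit_vec ` {(v0, False)})"
      "card (edge_row p ` F \<union> unit_vec ` {(v0, False)}) = card F + 1"
    using card_image[OF inj_on_subset[OF inj_on_row[OF min] F(1)]] by (auto simp: translation_row)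
  have "\<exists>D. finite D \<and> D \<subseteq> insert (v0, False) (\<Union>H\<in>\<H>. verts H \<times> UNIV) \<and>
      independent (edge_row p ` F \<union> unit_vec ` D) \<and>
      card (edge_row p ` F \<union> unit_vec ` D) = card F + 1 + (\<Sum>H\<in>\<H>. 2 - card (anchors F H))"
    if "finite \<H>" "\<H> \<subseteq> comps F" for \<H>
    using that
  proof (induction \<H>)
    case empty
    show ?case
      using start by (intro exI[of _ "{(v0, False)}"]) auto
  next
    case (insert H \<H>)
    then obtain D where D: "finite D" "D \<subseteq> insert (v0, False) (\<Union>H\<in>\<H>. verts H \<times> UNIV)"
      "independent (edge_row p ` F \<union> unit_vec ` D)"
      "card (edge_row p ` F \<union> unit_vec ` D) = card F + 1 + (\<Sum>H\<in>\<H>. 2 - card (anchors F H))"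
      by blast
    have H: "H \<in> comps F"
      using insert.prems by blast
    have "verts H \<inter> verts H' = {}" if "H' \<in> \<H>" for H'
      using comps_unique[OF H, of H'] that insert.prems insert.hyps(2) by blast
    then have "D \<inter> verts H \<times> UNIV \<subseteq> {(v0, False)}"
      using D(2) by blast
    from add_component[OF min p F(1) H v0(2) D(3,1) this]
    obtain D' where D': "D' - D \<subseteq> verts H \<times> UNIV" "finite D'"
      "independent (edge_row p ` F \<union> unit_vec ` D')"
      "card (edge_row p ` F \<union> unit_vec ` D') =
        card (edge_row p ` F \<union> unit_vec ` D) + (2 - card (anchors F H))"
      by blast
    have "D' \<subseteq> insert (v0, False) (\<Union>H\<in>insert H \<H>. verts H \<times> UNIV)"
      using D'(1) D(2) by blast
    then show ?case
      using D' D(4) insert.hyps by (intro exI[of _ D']) simp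
  qed
  from this[OF finite_comps order_refl]
  obtain D where D: "D \<subseteq> insert (v0, False) (\<Union>H\<in>comps F. verts H \<times> UNIV)"
    "independent (edge_row p ` F \<union> unit_vec ` D)"
    "card (edge_row p ` F \<union> unit_vec ` D) = card F + 1 + (\<Sum>H\<in>comps F. 2 - card (anchors F H))"
    by blast
  have "(v0, False) \<in> coords (\<Union>F)"
    using v0(1) \<open>v0 \<in> VP \<union> VL\<close> by (auto simp: coords_iff)
  moreover have "verts H \<times> UNIV \<subseteq> coords (\<Union>F)" if "H \<in> comps F" for H
    using in_comps_subset[OF that] by (auto simp: coords_def)
  ultimately have "D \<subseteq> coords (\<Union>F)"
    using D(1) by blast
  then have "unit_vec ` D \<subseteq> span (unit_vec ` coords (\<Union>F))"
    by (auto intro: span_base)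
  moreover have "edge_row p ` F \<subseteq> span (unit_vec ` coords (\<Union>F))"
    using row_in_span[OF F(1)] by blast
  ultimately have "edge_row p ` F \<union> unit_vec ` D \<subseteq> span (unit_vec ` coords (\<Union>F))"
    by simp
  then have "card (edge_row p ` F \<union> unit_vec ` D) \<le> card (coords (\<Union>F))"
    using independent_span_bound[OF finite_imageI[OF finite_coords] D(2)] card_unit_vec_image by metis
  \<comment> \<open>Truncated subtraction on natural numbers takes the place of the maximum with
    0.\<close>
  moreover have "deficit F = int (\<Sum>H\<in>comps F. 2 - card (anchors F H))"
    unfolding deficit_def of_nat_sum by (intro sum.cong) auto
  ultimately show ?thesis
    using D(3) by linarith
qed

lemma realisable_iff:
  assumes "VL \<noteq> {}"
  shows "(\<exists>p :: 'v \<Rightarrow> real^2. minimally_infinitesimally_rigid G VL p \<and> (\<forall>i\<in>VL. p i = vector [x i, 0])) \<longleftrightarrow>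
    card (edges G) + 1 = card (coords UNIV) \<and>
    (\<forall>e\<in>edges G. s e \<in> VL \<longrightarrow> t e \<in> VL \<longrightarrow> x (s e) \<noteq> x (t e)) \<and>
    (\<forall>F. F \<noteq> {} \<and> F \<subseteq> edges G \<longrightarrow> int (card F) + 1 + deficit F \<le> int (card (coords (\<Union>F))))"
    (is "?L \<longleftrightarrow> ?R")
proof
  assume ?L
  then obtain p :: "'v \<Rightarrow> real^2" where min: "minimally_infinitesimally_rigid G VL p"
    and p: "\<And>i. i \<in> VL \<Longrightarrow> p i = vector [x i, 0]"
    by blast
  have "x (s e) \<noteq> x (t e)" if "e \<in> edges G" "s e \<in> VL" "t e \<in> VL" for e
    using ends_distinct[OF min that(1)] p that(2,3) by metis
  then show ?R
    using card_edges[OF min] assms card_rows_le[OF min p] by blast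
next
  assume ?R
  then show ?L
    using rigid_placement[OF assms] by blast
qed

end

theorem theorem4p5:
  fixes G :: "'v graph" and VP VL :: "'v set" and x :: "'v \<Rightarrow> real"
  assumes "point_line_graph VP VL G"
    and "card VL \<ge> 2"
  shows "(\<exists>p :: 'v \<Rightarrow> real^2.
            minimally_infinitesimally_rigid G VL p \<and> (\<forall>i\<in>VL. p i = vector [x i, 0]))
     \<longleftrightarrow>
         (int (card (edges G)) = 2 * int (card VP) + int (card VL) - 1 \<and>
          (\<forall>i j. {i, j} \<in> edges_LL VL G \<longrightarrow> x i \<noteq> x j) \<and>
          (\<forall>F. F \<noteq> {} \<and> F \<subseteq> edges G \<longrightarrow>
             int (card F) \<le> 2 * int (nu VP F) + int (nu VL F) - 1
               - (\<Sum>H\<in>graph_components (point_graph VP VL (edge_subgraph F)).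
                    max 0 (2 - int (card {x j |i j. {i, j} \<in> F \<inter> edges_PL VP VL G \<and>
                                                     i \<in> verts H \<and> j \<in> VL})))))"
proof -
  have "\<exists>i j. e = {i, j} \<and> (j \<in> VP \<longrightarrow> i \<in> VP)" if "e \<in> edges G" for e
  proof -
    have "card e = 2"
      using assms(1) that by (simp add: point_line_graph_def simple_graph_def)
    then obtain i j where "e = {i, j}"
      by (meson card_2_iff)
    then show ?thesis
      by (metis insert_commute)
  qed
  then obtain s t where st: "\<And>e. e \<in> edges G \<Longrightarrow> e = {s e, t e} \<and> (t e \<in> VP \<longrightarrow> s e \<in> VP)"
    by metis
  interpret oriented_point_line_graph VP VL G x s t
    using assms(1) st by unfold_locales blast+
  have "VL \<noteq> {}"
    using assms(2) by auto
  have LL: "(\<forall>e\<in>edges G. s e \<in> VL \<longrightarrow> t e \<in> VL \<longrightarrow> x (s e) \<noteq> x (t e)) \<longleftrightarrow>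
      (\<forall>i j. {i, j} \<in> edges_LL VL G \<longrightarrow> x i \<noteq> x j)" (is "?A \<longleftrightarrow> ?B")
  proof
    assume A: ?A
    show ?B
    proof (intro allI impI)
      fix i j assume "{i, j} \<in> edges_LL VL G"
      then have ij: "{i, j} \<in> edges G" "i \<in> VL" "j \<in> VL"
        by (auto simp: edges_LL_def)
      then have "i = s {i, j} \<and> j = t {i, j} \<or> i = t {i, j} \<and> j = s {i, j}"
        using ends[of "{i, j}"] by (metis doubleton_eq_iff)
      then show "x i \<noteq> x j"
        using A ij by metis
    qed
  next
    assume B: ?B
    show ?A
    proof (intro ballI impI)
      fix e assume e: "e \<in> edges G" "s e \<in> VL" "t e \<in> VL"
      have "{s e, t e} \<in> edges G"
        using e(1) ends[of e] by metis
      moreover have "{s e, t e} \<subseteq> VL"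
        using e(2,3) by simp
      ultimately have "{s e, t e} \<in> edges_LL VL G"
        by (simp add: edges_LL_def)
      then show "x (s e) \<noteq> x (t e)"
        using B by blast
    qed
  qed
  have count: "int (card F) + 1 + deficit F \<le> int (card (coords (\<Union>F))) \<longleftrightarrow>
      int (card F) \<le> 2 * int (nu VP F) + int (nu VL F) - 1
        - (\<Sum>H\<in>graph_components (point_graph VP VL (edge_subgraph F)).
             max 0 (2 - int (card {x j |i j. {i, j} \<in> F \<inter> edges_PL VP VL G \<and> i \<in> verts H \<and> j \<in> VL})))" for F
    unfolding deficit_def comps_def anchors_def card_coords_Union by linarith
  have total: "card (edges G) + 1 = card (coords UNIV) \<longleftrightarrow>
      int (card (edges G)) = 2 * int (card VP) + int (card VL) - 1"
    unfolding card_coords_UNIV by linarith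
  show ?thesis
    unfolding realisable_iff[OF \<open>VL \<noteq> {}\<close>] LL count total ..
qed

end
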